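(* Let $G=(V,E)$ be a connected graph, let $K,L\in\mathbb{N}$, and fix distinct edges $e_1=\{u_1,v_1\},\dots,e_K=\{u_K,v_K\}\in E$ and distinct vertices $w_1,\dots,w_L\in V$. Let $\mathbb{G}=(\mathbb{V},\mathbb{E})$ be the associated unoriented ladder graph, and for $\mathbf{q}\in(0,1)^{K+L}$ let $p_c(\mathbf{q})=\sup\{p\in[0,1]:\mathbb{P}_{\mathbf{q},p}(C_\infty)=0\}$ be the critical parameter of the inhomogeneous percolation model on $\mathbb{G}$ with distinguished columns given by $e_1,\dots,e_K,w_1,\dots,w_L$. Then the function $\mathbf{q}\mapsto p_c(\mathbf{q})$ is continuous on $(0,1)^{K+L}$.
   Context: Given a connected (unoriented) graph $G=(V,E)$, the ladder graph $\mathbb{G}=(\mathbb{V},\mathbb{E})$ has vertex set $\mathbb{V}=V\times\mathbb{Z}$ and (unoriented) edge set $$\mathbb{E}=\{\{(u,n),(v,n)\}:\{u,v\}\in E,\ n\in\mathbb{Z}\}\cup\{\{(u,n),(u,n+1)\}:u\in V,\ n\in\mathbb{Z}\}.$$ A percolation configuration is an element $\omega\in\{0,1\}^{\mathbb{E}}$; the edge $e$ is open if $\omega(e)=1$ and closed if $\omega(e)=0$. An open path is a sequence of distinct vertices of $\mathbb{G}$ whose consecutive members are joined by open edges. The cluster of a vertex is the set of vertices that are equal to it or connected to it by an open path. $C_\infty$ is the event that there is an infinite cluster in $\mathbb{G}$. For the fixed edges $e_i=\{u_i,v_i\}$ ($1\le i\le K$) and vertices $w_j$ ($1\le j\le L$),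 define $$\mathbb{E}^i=\{\{(u_i,n),(v_i,n)\}:n\in\mathbb{Z}\}\ (1\le i\le K),\qquad \mathbb{E}^{K+j}=\{\{(w_j,n),(w_j,n+1)\}:n\in\mathbb{Z}\}\ (1\le j\le L).$$ For $\mathbf{q}=(q_1,\dots,q_{K+L})\in(0,1)^{K+L}$ and $p\in[0,1]$, $\mathbb{P}_{\mathbf{q},p}$ is the law on $\{0,1\}^{\mathbb{E}}$ under which the edges are independent, each edge of $\mathbb{E}^i$ is open with probability $q_i$ ($1\le i\le K+L$), and each edge of $\mathbb{E}\setminus\bigcup_{i=1}^{K+L}\mathbb{E}^i$ is open with probability $p$. *)

theory Defs
  imports "HOL-Probability.Probability"
begin

definition simple_graph :: "'a set \<Rightarrow> 'a set set \<Rightarrow> bool" where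
  "simple_graph V E \<longleftrightarrow> E \<subseteq> {{u, v} | u v. u \<in> V \<and> v \<in> V \<and> u \<noteq> v}"

definition graph_path :: "'a set \<Rightarrow> 'a set set \<Rightarrow> 'a list \<Rightarrow> bool" where
  "graph_path V E xs \<longleftrightarrow> xs \<noteq> [] \<and> distinct xs \<and> set xs \<subseteq> V \<and>
     (\<forall>i. Suc i < length xs \<longrightarrow> {xs ! i, xs ! Suc i} \<in> E)"

definition connected_graph :: "'a set \<Rightarrow> 'a set set \<Rightarrow> bool" where
  "connected_graph V E \<longleftrightarrow> simple_graph V E \<and>
     (\<forall>u\<in>V. \<forall>v\<in>V. \<exists>xs. graph_path V E xs \<and> hd xs = u \<and> last xs = v)"

definition ladder_verts :: "'v set \<Rightarrow> ('v \<times> int) set" where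
  "ladder_verts V = V \<times> UNIV"

definition ladder_edges :: "'v set \<Rightarrow> 'v set set \<Rightarrow> ('v \<times> int) set set" where
  "ladder_edges V E =
     {{(u, n), (v, n)} | u v n. {u, v} \<in> E} \<union> {{(u, n), (u, n + 1)} | u n. u \<in> V}"

(* A configuration is a function into bool on the ladder edges; True means open. *)

definition open_path ::
    "'v set \<Rightarrow> 'v set set \<Rightarrow> (('v \<times> int) set \<Rightarrow> bool) \<Rightarrow> ('v \<times> int) list \<Rightarrow> bool" where
  "open_path V E \<omega> xs \<longleftrightarrow> graph_path (ladder_verts V) {e \<in> ladder_edges V E. \<omega> e} xs"

definition open_cluster ::
    "'v set \<Rightarrow> 'v set set \<Rightarrow> (('v \<times> int) set \<Rightarrow> bool) \<Rightarrow> 'v \<times> int \<Rightarrow> ('v \<times> int) set" where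
  "open_cluster V E \<omega> x =
     {y. y = x \<or> (\<exists>xs. open_path V E \<omega> xs \<and> hd xs = x \<and> last xs = y)}"

definition infinite_cluster_event ::
    "'v set \<Rightarrow> 'v set set \<Rightarrow> (('v \<times> int) set \<Rightarrow> bool) set" where
  "infinite_cluster_event V E =
     {\<omega> \<in> ladder_edges V E \<rightarrow>\<^sub>E UNIV. \<exists>x\<in>ladder_verts V. infinite (open_cluster V E \<omega> x)}"

(* Indices 1..K are the rung columns over the edges {u i, v i}; indices K+1..K+L are the
   vertical columns over the vertices w 1, ..., w L. *)
definition column ::
    "nat \<Rightarrow> (nat \<Rightarrow> 'v) \<Rightarrow> (nat \<Rightarrow> 'v) \<Rightarrow> (nat \<Rightarrow> 'v) \<Rightarrow> nat \<Rightarrow> ('v \<times> int) set set" where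
  "column K u v w i =
     (if i \<le> K then {{(u i, n), (v i, n)} | n. True}
      else {{(w (i - K), n), (w (i - K), n + 1)} | n. True})"

definition edge_prob ::
    "nat \<Rightarrow> nat \<Rightarrow> (nat \<Rightarrow> 'v) \<Rightarrow> (nat \<Rightarrow> 'v) \<Rightarrow> (nat \<Rightarrow> 'v) \<Rightarrow> (nat \<Rightarrow> real) \<Rightarrow> real \<Rightarrow>
     ('v \<times> int) set \<Rightarrow> real" where
  "edge_prob K L u v w q p e =
     (if \<exists>i\<in>{1..K + L}. e \<in> column K u v w i
      then q (THE i. i \<in> {1..K + L} \<and> e \<in> column K u v w i) else p)"

lemma column_unique:
  assumes "\<And>i. i \<in> {1..K} \<Longrightarrow> u i \<noteq> v i"
    and "inj_on (\<lambda>i. {u i, v i}) {1..K}" and "inj_on w {1..L}"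
    and "i \<in> {1..K + L}" "j \<in> {1..K + L}" "e \<in> column K u v w i" "e \<in> column K u v w j"
  shows "i = j"
proof -
  have img: "fst ` e = (if k \<le> K then {u k, v k} else {w (k - K)})"
    if "e \<in> column K u v w k" for k
    using that by (auto simp: column_def split: if_splits)
  have eq: "(if i \<le> K then {u i, v i} else {w (i - K)}) =
      (if j \<le> K then {u j, v j} else {w (j - K)})"
    using img assms(6,7) by metis
  show ?thesis
  proof (cases "i \<le> K"; cases "j \<le> K")
    assume "i \<le> K" "j \<le> K"
    then show ?thesis using eq assms(2,4,5) by (auto dest: inj_onD)
  next
    assume "i \<le> K" "\<not> j \<le> K"
    then show ?thesis using eq assms(1)[of i] assms(4) by auto
  next
    assume "\<not> i \<le> K" "j \<le> K"
    then show ?thesis using eq assms(1)[of j] assms(5) by auto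
  next
    assume ij: "\<not> i \<le> K" "\<not> j \<le> K"
    then have "i - K = j - K"
      using eq assms(3,4,5) by (intro inj_onD[OF assms(3)]) auto
    then show ?thesis using ij by simp
  qed
qed

lemma edge_prob_column:
  assumes "\<And>i. i \<in> {1..K} \<Longrightarrow> u i \<noteq> v i"
    and "inj_on (\<lambda>i. {u i, v i}) {1..K}" and "inj_on w {1..L}"
    and "i \<in> {1..K + L}" "e \<in> column K u v w i"
  shows "edge_prob K L u v w q p e = q i"
proof -
  have "(THE i. i \<in> {1..K + L} \<and> e \<in> column K u v w i) = i"
    using assms(4,5) column_unique[OF assms(1-3)] by (intro the_equality) blast+
  then show ?thesis using assms(4,5) unfolding edge_prob_def by auto
qed

definition percolation ::
    "'v set \<Rightarrow> 'v set set \<Rightarrow> nat \<Rightarrow> nat \<Rightarrow> (nat \<Rightarrow> 'v) \<Rightarrow> (nat \<Rightarrow> 'v) \<Rightarrow> (nat \<Rightarrow> 'v) \<Rightarrow>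
     (nat \<Rightarrow> real) \<Rightarrow> real \<Rightarrow> (('v \<times> int) set \<Rightarrow> bool) measure" where
  "percolation V E K L u v w q p =
     (\<Pi>\<^sub>M e\<in>ladder_edges V E. measure_pmf (bernoulli_pmf (edge_prob K L u v w q p e)))"

(* The infinite-cluster event is in the product sigma-algebra when V is countable. For uncountable
   connected V it is not, and measure then returns the default value 0. *)
definition critical_param ::
    "'v set \<Rightarrow> 'v set set \<Rightarrow> nat \<Rightarrow> nat \<Rightarrow> (nat \<Rightarrow> 'v) \<Rightarrow> (nat \<Rightarrow> 'v) \<Rightarrow> (nat \<Rightarrow> 'v) \<Rightarrow>
     (nat \<Rightarrow> real) \<Rightarrow> real" where
  "critical_param V E K L u v w q =
     Sup {p \<in> {0..1}. measure (percolation V E K L u v w q p) (infinite_cluster_event V E) = 0}"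

end

theory Submission
  imports Defs
begin

text \<open>
  Continuity follows from a trade-off: for every \<open>q\<close> and \<open>d > 0\<close> there is
  an \<open>\<epsilon> > 0\<close> such that, for all \<open>qa\<close> and \<open>qb\<close> that
  are \<open>\<epsilon>\<close>-close to \<open>q\<close> and all \<open>p1 + d \<le> p2\<close>,
  percolation at \<open>(qa, p1)\<close> implies percolation at \<open>(qb, p2)\<close>
  (\<open>perc_trade_off\<close>). Critical values at two points near \<open>q\<close> can then
  differ by at most \<open>2 d\<close>.

  Some cases are degenerate. If \<open>V\<close> is uncountable, the event is not measurable and its
  measure is 0 by convention (\<open>countable_of_measurable_event\<close>). If \<open>V\<close> is
  finite, closed horizontal cuts prevent percolation for \<open>p < 1\<close>
  (\<open>no_percolation_finite_base\<close>); the same argument for \<open>p = 0\<close> shows that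
  the supremum that defines the critical parameter is over a nonempty set. At a vertex of infinite
  degree there is percolation for every \<open>p > 0\<close>
  (\<open>percolation_infinite_degree\<close>).

  In the main case the base is infinite and locally finite. The edges near the columns are cut into
  finite blocks, translates of each other, and the parameters are exchanged one block at a time.
  Call a function of the configuration in a block admissible if it increases whenever the
  configuration connects more pairs of outer vertices of the block, that is, vertices that may have
  edges outside the block. It suffices that the exchange does not decrease the expectation of any
  admissible \<open>g\<close> (\<open>infinite_reach_comparison\<close>). A change of the column
  parameters by \<open>\<epsilon>\<close> costs at most a multiple of \<open>\<epsilon>\<close>
  times the oscillation of \<open>g\<close>. The gain from the increase of \<open>p\<close> could
  vanish, unless some configuration of the column edges leaves the whole oscillation of
  \<open>g\<close> to the other edges: with these closed it connects no two outer vertices, and with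
  these open it connects as many as the full block. Then the gain is a fixed multiple of the
  oscillation and exceeds the cost for small \<open>\<epsilon>\<close>
  (\<open>block_dominatedI\<close>). Such a configuration is given by nested hooks, one for each
  vertex in the bottom and the top layer over the finite part of the base that carries the block.
  Each hook leads along column edges, except where the other edges help, to a vertical line without
  column edges, and distinct hooks are disjoint (\<open>pattern_isolates\<close>,
  \<open>pattern_connects\<close>).
\<close>

section \<open>Expectations over finitely many independent edges\<close>

text \<open>A configuration on the edge set \<open>J\<close> is represented by its set \<open>\<eta>\<close> of open edges; this is its
  probability if every edge \<open>e\<close> is open independently with probability \<open>\<rho> e\<close>.\<close>
definition bern_weight :: "('e \<Rightarrow> real) \<Rightarrow> 'e set \<Rightarrow> 'e set \<Rightarrow> real" where
  "bern_weight \<rho> J \<eta> = (\<Prod>e\<in>J. if e \<in> \<eta> then \<rho> e else 1 - \<rho> e)"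

text \<open>The expectation of \<open>g\<close> under this law, for finite \<open>J\<close>.\<close>
definition bern_expect :: "('e \<Rightarrow> real) \<Rightarrow> 'e set \<Rightarrow> ('e set \<Rightarrow> real) \<Rightarrow> real" where
  "bern_expect \<rho> J g = (\<Sum>\<eta>\<in>Pow J. bern_weight \<rho> J \<eta> * g \<eta>)"

lemma bern_expect_empty [simp]: "bern_expect \<rho> {} g = g {}"
  by (simp add: bern_expect_def bern_weight_def)

lemma bern_expect_cong:
  assumes "\<And>\<eta>. \<eta> \<subseteq> J \<Longrightarrow> g \<eta> = h \<eta>"
  shows "bern_expect \<rho> J g = bern_expect \<rho> J h"
  unfolding bern_expect_def using assms by (intro sum.cong) auto

lemma bern_expect_linear:
  "bern_expect \<rho> J (\<lambda>\<eta>. a * g \<eta> + b * h \<eta>) = a * bern_expect \<rho> J g + b * bern_expect \<rho> J h"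
  unfolding bern_expect_def by (simp add: sum.distrib sum_distrib_left algebra_simps)

lemma bern_expect_cmult: "bern_expect \<rho> J (\<lambda>\<eta>. a * g \<eta>) = a * bern_expect \<rho> J g"
  using bern_expect_linear[of \<rho> J a g 0 g] by simp

lemma bern_expect_insert:
  assumes "finite J" "e \<notin> J"
  shows "bern_expect \<rho> (insert e J) g =
    \<rho> e * bern_expect \<rho> J (\<lambda>\<eta>. g (insert e \<eta>)) + (1 - \<rho> e) * bern_expect \<rho> J g"
proof -
  have inj: "inj_on (insert e) (Pow J)"
    using assms(2) by (auto simp: inj_on_def)
  have w1: "bern_weight \<rho> (insert e J) (insert e \<eta>) = \<rho> e * bern_weight \<rho> J \<eta>" for \<eta>
  proof -
    have "(\<Prod>x\<in>J. if x = e \<or> x \<in> \<eta> then \<rho> x else 1 - \<rho> x) = (\<Prod>x\<in>J. if x \<in> \<eta> then \<rho> x else 1 - \<rho> x)"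
      using assms by (intro prod.cong) auto
    then show ?thesis using assms by (simp add: bern_weight_def)
  qed
  have w0: "bern_weight \<rho> (insert e J) \<eta> = (1 - \<rho> e) * bern_weight \<rho> J \<eta>" if "\<eta> \<subseteq> J" for \<eta>
    using assms that unfolding bern_weight_def by auto
  have "bern_expect \<rho> (insert e J) g =
      (\<Sum>\<eta>\<in>Pow J. bern_weight \<rho> (insert e J) \<eta> * g \<eta>) +
      (\<Sum>\<eta>\<in>insert e ` Pow J. bern_weight \<rho> (insert e J) \<eta> * g \<eta>)"
    unfolding bern_expect_def Pow_insert using assms by (intro sum.union_disjoint) auto
  also have "(\<Sum>\<eta>\<in>insert e ` Pow J. bern_weight \<rho> (insert e J) \<eta> * g \<eta>) =
      (\<Sum>\<eta>\<in>Pow J. \<rho> e * (bern_weight \<rho> J \<eta> * g (insert e \<eta>)))"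
    by (subst sum.reindex[OF inj]) (simp add: w1 mult.assoc)
  also have "(\<Sum>\<eta>\<in>Pow J. bern_weight \<rho> (insert e J) \<eta> * g \<eta>) =
      (\<Sum>\<eta>\<in>Pow J. (1 - \<rho> e) * (bern_weight \<rho> J \<eta> * g \<eta>))"
    by (intro sum.cong) (auto simp: w0)
  finally show ?thesis
    by (simp add: bern_expect_def sum_distrib_left)
qed

text \<open>Fubini for two disjoint sets of edges.\<close>
lemma bern_expect_split:
  assumes "finite J" "finite B" "J \<inter> B = {}"
  shows "bern_expect \<rho> (J \<union> B) g = bern_expect \<rho> J (\<lambda>\<zeta>. bern_expect \<rho> B (\<lambda>\<eta>. g (\<zeta> \<union> \<eta>)))"
  using assms(2,3)
proof (induction B arbitrary: g rule: finite_induct)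
  case (insert e B)
  have "bern_expect \<rho> (J \<union> insert e B) g = bern_expect \<rho> (insert e (J \<union> B)) g"
    by simp
  also have "\<dots> = \<rho> e * bern_expect \<rho> (J \<union> B) (\<lambda>\<eta>. g (insert e \<eta>)) + (1 - \<rho> e) * bern_expect \<rho> (J \<union> B) g"
    using insert assms(1) by (intro bern_expect_insert) auto
  also have "\<dots> = bern_expect \<rho> J (\<lambda>\<zeta>. \<rho> e * bern_expect \<rho> B (\<lambda>\<eta>. g (insert e (\<zeta> \<union> \<eta>))) +
      (1 - \<rho> e) * bern_expect \<rho> B (\<lambda>\<eta>. g (\<zeta> \<union> \<eta>)))"
    using insert by (simp add: bern_expect_linear)
  also have "\<dots> = bern_expect \<rho> J (\<lambda>\<zeta>. bern_expect \<rho> (insert e B) (\<lambda>\<eta>. g (\<zeta> \<union> \<eta>)))"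
    using insert by (intro bern_expect_cong) (simp add: bern_expect_insert)
  finally show ?case .
qed simp

lemma bern_weight_nonneg:
  assumes "\<And>e. e \<in> J \<Longrightarrow> 0 \<le> \<rho> e \<and> \<rho> e \<le> 1"
  shows "0 \<le> bern_weight \<rho> J \<eta>"
  unfolding bern_weight_def using assms by (intro prod_nonneg) auto

lemma bern_expect_mono:
  assumes "\<And>e. e \<in> J \<Longrightarrow> 0 \<le> \<rho> e \<and> \<rho> e \<le> 1"
    and "\<And>\<eta>. \<eta> \<subseteq> J \<Longrightarrow> g \<eta> \<le> h \<eta>"
  shows "bern_expect \<rho> J g \<le> bern_expect \<rho> J h"
  unfolding bern_expect_def using assms
  by (intro sum_mono mult_left_mono bern_weight_nonneg) auto

lemma bern_expect_const:
  assumes "finite J" shows "bern_expect \<rho> J (\<lambda>_. c) = c"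
  using assms
proof (induction J rule: finite_induct)
  case (insert x F)
  then show ?case
    by (simp add: bern_expect_insert algebra_simps)
qed simp

text \<open>Swapping the parameters changes an expectation by at most the total change of the parameters
  times the oscillation of the integrand.\<close>
lemma bern_expect_lipschitz:
  assumes "finite J"
    and "\<And>e. e \<in> J \<Longrightarrow> 0 \<le> \<rho> e \<and> \<rho> e \<le> 1" and "\<And>e. e \<in> J \<Longrightarrow> 0 \<le> \<rho>' e \<and> \<rho>' e \<le> 1"
    and "\<And>\<eta>. \<eta> \<subseteq> J \<Longrightarrow> a \<le> g \<eta> \<and> g \<eta> \<le> b"
  shows "bern_expect \<rho> J g - bern_expect \<rho>' J g \<le> (\<Sum>e\<in>J. \<bar>\<rho> e - \<rho>' e\<bar>) * (b - a)"
  using assms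
proof (induction J arbitrary: g rule: finite_induct)
  case (insert e J)
  define g1 where "g1 = (\<lambda>\<eta>. g (insert e \<eta>))"
  have b1: "a \<le> g1 \<eta> \<and> g1 \<eta> \<le> b" if "\<eta> \<subseteq> J" for \<eta>
    unfolding g1_def using that insert.prems(3)[of "insert e \<eta>"] by auto
  have b0: "a \<le> g \<eta> \<and> g \<eta> \<le> b" if "\<eta> \<subseteq> J" for \<eta>
    using that insert.prems(3)[of \<eta>] by auto
  let ?D = "(\<Sum>e\<in>J. \<bar>\<rho> e - \<rho>' e\<bar>) * (b - a)"
  have i1: "bern_expect \<rho> J g1 - bern_expect \<rho>' J g1 \<le> ?D"
    using insert.prems b1 by (intro insert.IH) auto
  have i0: "bern_expect \<rho> J g - bern_expect \<rho>' J g \<le> ?D"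
    using insert.prems b0 by (intro insert.IH) auto
  have lohi: "a \<le> bern_expect \<rho>' J h \<and> bern_expect \<rho>' J h \<le> b"
    if "\<And>\<eta>. \<eta> \<subseteq> J \<Longrightarrow> a \<le> h \<eta> \<and> h \<eta> \<le> b" for h
    using bern_expect_mono[of J \<rho>' "\<lambda>_. a" h] bern_expect_mono[of J \<rho>' h "\<lambda>_. b"] that
      insert.prems(2) insert.hyps(1) by (simp add: bern_expect_const)
  have r: "0 \<le> \<rho> e" "\<rho> e \<le> 1" using insert.prems(1) by auto
  have "\<bar>bern_expect \<rho>' J g1 - bern_expect \<rho>' J g\<bar> \<le> b - a"
  proof -
    have "a \<le> bern_expect \<rho>' J g1 \<and> bern_expect \<rho>' J g1 \<le> b" by (rule lohi) (rule b1)
    moreover have "a \<le> bern_expect \<rho>' J g \<and> bern_expect \<rho>' J g \<le> b" by (rule lohi) (rule b0)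
    ultimately show ?thesis by (simp add: abs_le_iff)
  qed
  from mult_left_mono[OF this abs_ge_zero] have last: "(\<rho> e - \<rho>' e) * (bern_expect \<rho>' J g1 - bern_expect \<rho>' J g) \<le> \<bar>\<rho> e - \<rho>' e\<bar> * (b - a)"
    by (intro order_trans[OF abs_ge_self[of "(\<rho> e - \<rho>' e) * _"]]) (simp only: abs_mult)
  have "bern_expect \<rho> (insert e J) g - bern_expect \<rho>' (insert e J) g =
      \<rho> e * (bern_expect \<rho> J g1 - bern_expect \<rho>' J g1) +
      (1 - \<rho> e) * (bern_expect \<rho> J g - bern_expect \<rho>' J g) +
      (\<rho> e - \<rho>' e) * (bern_expect \<rho>' J g1 - bern_expect \<rho>' J g)"
    using insert.hyps by (simp add: bern_expect_insert g1_def algebra_simps)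
  also have "\<dots> \<le> \<rho> e * ?D + (1 - \<rho> e) * ?D + \<bar>\<rho> e - \<rho>' e\<bar> * (b - a)"
    using r i1 i0 last by (intro add_mono mult_left_mono) auto
  also have "\<dots> = (\<Sum>e\<in>insert e J. \<bar>\<rho> e - \<rho>' e\<bar>) * (b - a)"
    using insert.hyps by (simp add: algebra_simps)
  finally show ?case .
qed simp

text \<open>A quantitative form of monotonicity. In the natural coupling by uniform variables, the event
  that every variable lies between \<open>\<rho>\<close> and \<open>\<rho>'\<close> has the probability given by the product; on it
  the smaller configuration is empty and the larger one is full. The induction needs two
  functions.\<close>
lemma bern_expect_gain2:
  assumes "finite J"
    and "\<And>e. e \<in> J \<Longrightarrow> 0 \<le> \<rho> e \<and> \<rho> e \<le> \<rho>' e \<and> \<rho>' e \<le> 1"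
    and "\<And>\<eta> \<eta>'. \<eta> \<subseteq> \<eta>' \<Longrightarrow> \<eta>' \<subseteq> J \<Longrightarrow> g \<eta> \<le> g \<eta>'"
    and "\<And>\<eta> \<eta>'. \<eta> \<subseteq> \<eta>' \<Longrightarrow> \<eta>' \<subseteq> J \<Longrightarrow> h \<eta> \<le> h \<eta>'"
    and "\<And>\<eta>. \<eta> \<subseteq> J \<Longrightarrow> g \<eta> \<le> h \<eta>"
  shows "bern_expect \<rho>' J h - bern_expect \<rho> J g \<ge> (\<Prod>e\<in>J. \<rho>' e - \<rho> e) * (h J - g {})"
  using assms
proof (induction J arbitrary: g h rule: finite_induct)
  case (insert e J)
  define g1 where "g1 = (\<lambda>\<eta>. g (insert e \<eta>))"
  define h1 where "h1 = (\<lambda>\<eta>. h (insert e \<eta>))"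
  let ?P = "\<Prod>e\<in>J. \<rho>' e - \<rho> e"
  have P: "0 \<le> ?P" using insert.prems(1) by (intro prod_nonneg) auto
  have mg: "g \<eta> \<le> g \<eta>'" "g1 \<eta> \<le> g1 \<eta>'" "h \<eta> \<le> h \<eta>'" "h1 \<eta> \<le> h1 \<eta>'"
    if "\<eta> \<subseteq> \<eta>'" "\<eta>' \<subseteq> J" for \<eta> \<eta>'
    unfolding g1_def h1_def using that
    by (auto intro!: insert.prems(2,3))
  have le: "g \<eta> \<le> h \<eta>" "g1 \<eta> \<le> h1 \<eta>" "h \<eta> \<le> h1 \<eta>" if "\<eta> \<subseteq> J" for \<eta>
    unfolding g1_def h1_def using that
    by (auto intro!: insert.prems(3,4))
  have pr: "\<And>x. x \<in> J \<Longrightarrow> 0 \<le> \<rho> x \<and> \<rho> x \<le> \<rho>' x \<and> \<rho>' x \<le> 1"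
    using insert.prems(1) by auto
  have i1: "bern_expect \<rho>' J h1 - bern_expect \<rho> J g1 \<ge> ?P * (h1 J - g1 {})"
    by (rule insert.IH) (use pr mg le in auto)
  have i0: "bern_expect \<rho>' J h - bern_expect \<rho> J g \<ge> ?P * (h J - g {})"
    by (rule insert.IH) (use pr mg le in auto)
  have i10: "bern_expect \<rho>' J h1 - bern_expect \<rho> J g \<ge> ?P * (h1 J - g {})"
    by (rule insert.IH) (use pr mg le order_trans[OF le(1) le(3)] in auto)
  have "0 \<le> h1 J - g1 {}" using le(2)[of "{}"] mg(4)[of "{}" J] by auto
  then have n1: "bern_expect \<rho>' J h1 - bern_expect \<rho> J g1 \<ge> 0"
    using i1 P by (meson mult_nonneg_nonneg order_trans)
  have "0 \<le> h J - g {}" using le(1)[of "{}"] mg(3)[of "{}" J] by auto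
  then have n0: "bern_expect \<rho>' J h - bern_expect \<rho> J g \<ge> 0"
    using i0 P by (meson mult_nonneg_nonneg order_trans)
  have r: "0 \<le> \<rho> e" "\<rho> e \<le> \<rho>' e" "\<rho>' e \<le> 1" using insert.prems(1) by auto
  have "(\<Prod>x\<in>insert e J. \<rho>' x - \<rho> x) * (h (insert e J) - g {}) = (\<rho>' e - \<rho> e) * (?P * (h1 J - g {}))"
    using insert.hyps by (simp add: h1_def)
  also have "\<dots> \<le> (\<rho>' e - \<rho> e) * (bern_expect \<rho>' J h1 - bern_expect \<rho> J g)"
    using i10 r by (intro mult_left_mono) auto
  also have "\<dots> \<le> \<rho> e * (bern_expect \<rho>' J h1 - bern_expect \<rho> J g1) +
      (1 - \<rho>' e) * (bern_expect \<rho>' J h - bern_expect \<rho> J g) +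
      (\<rho>' e - \<rho> e) * (bern_expect \<rho>' J h1 - bern_expect \<rho> J g)"
    using n1 n0 r by simp
  also have "\<dots> = bern_expect \<rho>' (insert e J) h - bern_expect \<rho> (insert e J) g"
    using insert.hyps by (simp add: bern_expect_insert g1_def h1_def algebra_simps)
  finally show ?case .
qed simp

lemma bern_expect_gain:
  assumes "finite J"
    and "\<And>e. e \<in> J \<Longrightarrow> 0 \<le> \<rho> e \<and> \<rho> e \<le> \<rho>' e \<and> \<rho>' e \<le> 1"
    and "\<And>\<eta> \<eta>'. \<eta> \<subseteq> \<eta>' \<Longrightarrow> \<eta>' \<subseteq> J \<Longrightarrow> g \<eta> \<le> g \<eta>'"
  shows "bern_expect \<rho>' J g - bern_expect \<rho> J g \<ge> (\<Prod>e\<in>J. \<rho>' e - \<rho> e) * (g J - g {})"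
  using assms by (intro bern_expect_gain2) auto

section \<open>Infinite products of Bernoulli measures\<close>

text \<open>The law of independent edges on \<open>I\<close>. A configuration is a function into the booleans, open edges
  having the value \<open>True\<close>.\<close>
definition bern_product :: "('e \<Rightarrow> real) \<Rightarrow> 'e set \<Rightarrow> ('e \<Rightarrow> bool) measure" where
  "bern_product \<rho> I = (\<Pi>\<^sub>M e\<in>I. measure_pmf (bernoulli_pmf (\<rho> e)))"

lemma space_bern_product [simp]: "space (bern_product \<rho> I) = I \<rightarrow>\<^sub>E UNIV"
  by (simp add: bern_product_def space_PiM)

lemma sets_bern_product_cong: "sets (bern_product \<rho> I) = sets (bern_product \<rho>' I)"
  unfolding bern_product_def by (intro sets_PiM_cong) auto

lemma prob_space_bern_product: "prob_space (bern_product \<rho> I)"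
  unfolding bern_product_def by (intro prob_space_PiM prob_space_measure_pmf)

text \<open>Events that depend on finitely many edges have the finite expectations above as probabilities.\<close>
lemma bern_product_cylinder:
  fixes \<rho> :: "'e \<Rightarrow> real"
  assumes "finite J" "J \<subseteq> I" "\<And>e. e \<in> J \<Longrightarrow> 0 \<le> \<rho> e \<and> \<rho> e \<le> 1"
  shows "{\<omega> \<in> I \<rightarrow>\<^sub>E UNIV. {e\<in>J. \<omega> e} \<in> D} \<in> sets (bern_product \<rho> I)" (is ?S)
    and "measure (bern_product \<rho> I) {\<omega> \<in> I \<rightarrow>\<^sub>E UNIV. {e\<in>J. \<omega> e} \<in> D} =
      bern_expect \<rho> J (indicator D)" (is ?T)
proof -
  interpret product_prob_space "\<lambda>e. measure_pmf (bernoulli_pmf (\<rho> e))" I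
    by unfold_locales
  have PM: "bern_product \<rho> I = PiM I (\<lambda>e. measure_pmf (bernoulli_pmf (\<rho> e)))"
    by (simp add: bern_product_def)
  define C where "C \<eta> = prod_emb I (\<lambda>e. measure_pmf (bernoulli_pmf (\<rho> e))) J (Pi\<^sub>E J (\<lambda>e. {e \<in> \<eta>}))" for \<eta>
  have Ceq: "C \<eta> = {\<omega> \<in> I \<rightarrow>\<^sub>E UNIV. {e\<in>J. \<omega> e} = \<eta>}" if "\<eta> \<subseteq> J" for \<eta>
    using that assms(2) by (auto simp: C_def prod_emb_def PiE_iff restrict_def extensional_def)
  have Cs: "C \<eta> \<in> sets (bern_product \<rho> I)" for \<eta>
    unfolding PM C_def using assms by (intro sets_PiM_I) auto
  have Cm: "measure (bern_product \<rho> I) (C \<eta>) = bern_weight \<rho> J \<eta>" for \<eta>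
  proof -
    have "measure (bern_product \<rho> I) (C \<eta>) = (\<Prod>e\<in>J. measure (measure_pmf (bernoulli_pmf (\<rho> e))) {e \<in> \<eta>})"
      unfolding PM C_def using assms by (intro measure_PiM_emb) auto
    also have "\<dots> = bern_weight \<rho> J \<eta>"
      unfolding bern_weight_def using assms(3)
      by (intro prod.cong) (auto simp: measure_pmf_single)
    finally show ?thesis .
  qed
  have un: "{\<omega> \<in> I \<rightarrow>\<^sub>E UNIV. {e\<in>J. \<omega> e} \<in> D} = (\<Union>\<eta>\<in>Pow J \<inter> D. C \<eta>)"
    by (auto simp: Ceq)
  show ?S unfolding un using assms(1) Cs by (intro sets.finite_UN) auto
  have "measure (bern_product \<rho> I) (\<Union>\<eta>\<in>Pow J \<inter> D. C \<eta>) = (\<Sum>\<eta>\<in>Pow J \<inter> D. measure (bern_product \<rho> I) (C \<eta>))"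
    unfolding PM
  proof (rule P.finite_measure_finite_Union)
    show "finite (Pow J \<inter> D)" using assms(1) by simp
    show "C ` (Pow J \<inter> D) \<subseteq> P.events" using Cs unfolding PM by auto
    show "disjoint_family_on C (Pow J \<inter> D)" unfolding disjoint_family_on_def by (auto simp: Ceq)
  qed
  also have "\<dots> = bern_expect \<rho> J (indicator D)"
    unfolding bern_expect_def Cm
    by (rule sum.mono_neutral_cong_left) (use assms(1) in \<open>auto simp: indicator_def\<close>)
  finally show ?T unfolding un .
qed

text \<open>Independent trials: if the edge sets \<open>F n\<close> are disjoint and all edges of \<open>F n\<close> take the
  value \<open>b\<close> with a probability bounded away from 0, then almost surely this happens for infinitely
  many \<open>n\<close>.\<close>
lemma bern_product_infinitely_often:
  fixes F :: "nat \<Rightarrow> 'e set" and b :: bool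
  assumes fin: "\<And>n. finite (F n)" and sub: "\<And>n. F n \<subseteq> I" and dj: "disjoint_family F"
    and \<rho>: "\<And>e. e \<in> I \<Longrightarrow> 0 \<le> \<rho> e \<and> \<rho> e \<le> 1"
    and c: "0 < c" "\<And>n. c \<le> (\<Prod>e\<in>F n. if b then \<rho> e else 1 - \<rho> e)"
  shows "AE \<omega> in bern_product \<rho> I. \<forall>m. \<exists>n\<ge>m. \<forall>e\<in>F n. \<omega> e = b"
proof -
  interpret prob_space "bern_product \<rho> I" by (rule prob_space_bern_product)
  \<comment> \<open>\<open>f n\<close> indicates that trial \<open>n\<close> fails.\<close>
  define f where "f n \<eta> = (if \<forall>e\<in>F n. (e \<in> \<eta>) = b then 0 else 1 :: real)" for n \<eta>
  define U where "U m k = (\<Union>n\<in>{m..<m+k}. F n)" for m k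
  have finU: "finite (U m k)" and subU: "U m k \<subseteq> I" for m k
    using fin sub by (auto simp: U_def)
  have F1: "bern_expect \<rho> (F n) (f n) \<le> 1 - c" for n
  proof -
    \<comment> \<open>The only configuration on \<open>F n\<close> where \<open>f n\<close> vanishes.\<close>
    let ?t = "if b then F n else {}"
    have "bern_expect \<rho> (F n) (f n) = (\<Sum>\<eta>\<in>Pow (F n). bern_weight \<rho> (F n) \<eta> - (if \<eta> = ?t then bern_weight \<rho> (F n) \<eta> else 0))"
      unfolding bern_expect_def by (intro sum.cong) (auto simp: f_def)
    also have "\<dots> = bern_expect \<rho> (F n) (\<lambda>_. 1) - bern_weight \<rho> (F n) ?t"
      unfolding sum_subtractf bern_expect_def using fin by (subst sum.delta) auto
    also have "bern_weight \<rho> (F n) ?t = (\<Prod>e\<in>F n. if b then \<rho> e else 1 - \<rho> e)"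
      unfolding bern_weight_def by (intro prod.cong) auto
    finally show ?thesis using c(2)[of n] fin by (simp add: bern_expect_const)
  qed
  have f01: "0 \<le> f n \<eta>" for n \<eta> by (simp add: f_def)
  have F0: "0 \<le> bern_expect \<rho> (F n) (f n)" for n
    using bern_expect_mono[of "F n" \<rho> "\<lambda>_. 0" "f n"] f01 \<rho> sub[of n] fin[of n]
    by (auto simp: bern_expect_const)
  have c1: "c \<le> 1" using F1[of 0] F0[of 0] by linarith
  have E: "bern_expect \<rho> (U m k) (\<lambda>\<eta>. \<Prod>n\<in>{m..<m+k}. f n \<eta>) \<le> (1 - c) ^ k" for m k
  proof (induction k)
    case (Suc k)
    have disj: "F i \<inter> F j = {}" if "i \<noteq> j" for i j
      using dj that by (auto simp: disjoint_family_on_def)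
    have US: "U m (Suc k) = U m k \<union> F (m + k)"
    proof -
      have "{m..<m + Suc k} = insert (m + k) {m..<m + k}" by auto
      then show ?thesis unfolding U_def by (simp add: Un_commute)
    qed
    have d: "U m k \<inter> F (m + k) = {}"
    proof -
      have "F n \<inter> F (m + k) = {}" if "n \<in> {m..<m+k}" for n using that by (intro disj) auto
      then show ?thesis unfolding U_def by blast
    qed
    have "bern_expect \<rho> (U m (Suc k)) (\<lambda>\<eta>. \<Prod>n\<in>{m..<m+Suc k}. f n \<eta>) =
       bern_expect \<rho> (U m k) (\<lambda>\<zeta>. bern_expect \<rho> (F (m+k)) (\<lambda>\<eta>. \<Prod>n\<in>{m..<m+Suc k}. f n (\<zeta> \<union> \<eta>)))"
      unfolding US by (rule bern_expect_split) (use finU fin d in auto)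
    also have "\<dots> = bern_expect \<rho> (U m k) (\<lambda>\<zeta>. bern_expect \<rho> (F (m+k)) (f (m+k)) * (\<Prod>n\<in>{m..<m+k}. f n \<zeta>))"
    proof (rule bern_expect_cong)
      fix \<zeta> assume z: "\<zeta> \<subseteq> U m k"
      have "bern_expect \<rho> (F (m+k)) (\<lambda>\<eta>. \<Prod>n\<in>{m..<m+Suc k}. f n (\<zeta> \<union> \<eta>)) =
        bern_expect \<rho> (F (m+k)) (\<lambda>\<eta>. (\<Prod>n\<in>{m..<m+k}. f n \<zeta>) * f (m+k) \<eta>)"
      proof (rule bern_expect_cong)
        fix \<eta> assume e: "\<eta> \<subseteq> F (m+k)"
        have 1: "f n (\<zeta> \<union> \<eta>) = f n \<zeta>" if "n \<in> {m..<m+k}" for n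
        proof -
          have "e' \<notin> \<eta>" if "e' \<in> F n" for e'
            using that e disj[of n "m+k"] \<open>n \<in> {m..<m+k}\<close> by auto
          then show ?thesis unfolding f_def by auto
        qed
        have 2: "f (m+k) (\<zeta> \<union> \<eta>) = f (m+k) \<eta>"
        proof -
          have "e' \<notin> \<zeta>" if "e' \<in> F (m+k)" for e'
            using that z d by auto
          then show ?thesis unfolding f_def by auto
        qed
        show "(\<Prod>n\<in>{m..<m+Suc k}. f n (\<zeta> \<union> \<eta>)) = (\<Prod>n\<in>{m..<m+k}. f n \<zeta>) * f (m+k) \<eta>"
          using 1 2 by (simp add: prod.atLeastLessThan_Suc)
      qed
      then show "bern_expect \<rho> (F (m+k)) (\<lambda>\<eta>. \<Prod>n\<in>{m..<m+Suc k}. f n (\<zeta> \<union> \<eta>)) =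
         bern_expect \<rho> (F (m+k)) (f (m+k)) * (\<Prod>n\<in>{m..<m+k}. f n \<zeta>)"
        by (simp add: bern_expect_cmult)
    qed
    also have "\<dots> = bern_expect \<rho> (F (m+k)) (f (m+k)) * bern_expect \<rho> (U m k) (\<lambda>\<zeta>. \<Prod>n\<in>{m..<m+k}. f n \<zeta>)"
      by (rule bern_expect_cmult)
    also have "\<dots> \<le> (1 - c) * bern_expect \<rho> (U m k) (\<lambda>\<zeta>. \<Prod>n\<in>{m..<m+k}. f n \<zeta>)"
    proof (intro mult_right_mono F1)
      have "bern_expect \<rho> (U m k) (\<lambda>_. 0) \<le> bern_expect \<rho> (U m k) (\<lambda>\<zeta>. \<Prod>n\<in>{m..<m+k}. f n \<zeta>)"
        using f01 \<rho> subU[of m k] by (intro bern_expect_mono prod_nonneg) auto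
      then show "0 \<le> bern_expect \<rho> (U m k) (\<lambda>\<zeta>. \<Prod>n\<in>{m..<m+k}. f n \<zeta>)"
        using finU by (simp add: bern_expect_const)
    qed
    also have "\<dots> \<le> (1 - c) * (1 - c) ^ k" using Suc c1 by (intro mult_left_mono) auto
    finally show ?case by simp
  qed (simp add: U_def)
  define A where "A m k = {\<omega> \<in> I \<rightarrow>\<^sub>E UNIV. {e\<in>U m k. \<omega> e} \<in> {\<eta>. (\<Prod>n\<in>{m..<m+k}. f n \<eta>) = 1}}" for m k
  have f2: "(\<Prod>n\<in>S. f n \<eta>) = (if \<forall>n\<in>S. \<not> (\<forall>e\<in>F n. (e \<in> \<eta>) = b) then 1 else 0)" if "finite S" for S \<eta>
    using that by (induction S rule: finite_induct) (auto simp: f_def)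
  have Am: "A m k \<in> events" and Ap: "prob (A m k) \<le> (1 - c) ^ k" for m k
  proof -
    have \<rho>U: "\<And>e. e \<in> U m k \<Longrightarrow> 0 \<le> \<rho> e \<and> \<rho> e \<le> 1" using \<rho> subU by auto
    show "A m k \<in> events" unfolding A_def
      by (rule bern_product_cylinder(1)[OF finU subU \<rho>U])
    have "prob (A m k) = bern_expect \<rho> (U m k) (indicator {\<eta>. (\<Prod>n\<in>{m..<m+k}. f n \<eta>) = 1})"
      unfolding A_def by (rule bern_product_cylinder(2)[OF finU subU \<rho>U])
    also have "\<dots> = bern_expect \<rho> (U m k) (\<lambda>\<eta>. \<Prod>n\<in>{m..<m+k}. f n \<eta>)"
      by (intro bern_expect_cong) (simp add: f2 indicator_def)
    finally show "prob (A m k) \<le> (1 - c) ^ k" using E by simp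
  qed
  have "AE \<omega> in bern_product \<rho> I. \<exists>n\<ge>m. \<forall>e\<in>F n. \<omega> e = b" for m
  proof (rule AE_I[where N = "\<Inter>k. A m k"])
    show "(\<Inter>k. A m k) \<in> events" using Am by auto
    have "prob (\<Inter>k. A m k) \<le> (1 - c) ^ k" for k
      using Ap[of m k] finite_measure_mono[of "\<Inter>k. A m k" "A m k"] Am by (auto intro: order_trans)
    moreover have "(\<lambda>k. (1 - c) ^ k) \<longlonglongrightarrow> 0"
      using c(1) c1 by (intro LIMSEQ_power_zero) auto
    ultimately have "prob (\<Inter>k. A m k) \<le> 0"
      by (intro LIMSEQ_le_const) auto
    then show "emeasure (bern_product \<rho> I) (\<Inter>k. A m k) = 0"
      by (simp add: emeasure_eq_measure measure_le_0_iff)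
    show "{\<omega> \<in> space (bern_product \<rho> I). \<not> (\<exists>n\<ge>m. \<forall>e\<in>F n. \<omega> e = b)} \<subseteq> (\<Inter>k. A m k)"
    proof (intro subsetI INT_I)
      fix \<omega> k
      assume "\<omega> \<in> {\<omega> \<in> space (bern_product \<rho> I). \<not> (\<exists>n\<ge>m. \<forall>e\<in>F n. \<omega> e = b)}"
      then have \<omega>: "\<omega> \<in> I \<rightarrow>\<^sub>E UNIV" and *: "\<And>n. m \<le> n \<Longrightarrow> \<exists>e\<in>F n. \<omega> e \<noteq> b"
        by auto
      have "\<not> (\<forall>e\<in>F n. (e \<in> {e \<in> U m k. \<omega> e}) = b)" if n: "n \<in> {m..<m+k}" for n
      proof -
        have "F n \<subseteq> U m k" using n by (auto simp: U_def)
        then show ?thesis using *[of n] n by auto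
      qed
      then show "\<omega> \<in> A m k" using \<omega> by (simp add: A_def f2)
    qed
  qed
  then show ?thesis by (simp add: AE_all_countable)
qed

lemma sets_bern_product_countable_support:
  assumes "A \<in> sets (bern_product \<rho> I)"
  shows "\<exists>J\<subseteq>I. countable J \<and>
    (\<forall>\<omega>\<in>I \<rightarrow>\<^sub>E UNIV. \<forall>\<omega>'\<in>I \<rightarrow>\<^sub>E UNIV. (\<forall>i\<in>J. \<omega> i = \<omega>' i) \<longrightarrow> (\<omega> \<in> A \<longleftrightarrow> \<omega>' \<in> A))"
proof -
  have "A \<in> sigma_sets (I \<rightarrow>\<^sub>E UNIV) {{f \<in> I \<rightarrow>\<^sub>E UNIV. f i \<in> B} | i B. i \<in> I \<and> B \<in> (UNIV :: bool set set)}"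
    using assms by (simp add: bern_product_def sets_PiM_single)
  then show ?thesis
  proof (induction rule: sigma_sets.induct)
    case (Basic a)
    then obtain i B where "i \<in> I" "a = {f \<in> I \<rightarrow>\<^sub>E UNIV. f i \<in> B}" by auto
    then show ?case by (intro exI[of _ "{i}"]) auto
  next
    case Empty
    then show ?case by auto
  next
    case (Compl a)
    from Compl.IH obtain J where J: "J \<subseteq> I" "countable J"
      "\<forall>\<omega>\<in>I \<rightarrow>\<^sub>E UNIV. \<forall>\<omega>'\<in>I \<rightarrow>\<^sub>E UNIV. (\<forall>i\<in>J. \<omega> i = \<omega>' i) \<longrightarrow> (\<omega> \<in> a \<longleftrightarrow> \<omega>' \<in> a)"
      by (elim exE conjE)
    show ?case
    proof (intro exI[of _ J] conjI ballI impI)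
      fix \<omega> \<omega>' :: "'a \<Rightarrow> bool"
      assume *: "\<omega> \<in> I \<rightarrow>\<^sub>E UNIV" "\<omega>' \<in> I \<rightarrow>\<^sub>E UNIV" and eq: "\<forall>i\<in>J. \<omega> i = \<omega>' i"
      have "\<omega> \<in> a \<longleftrightarrow> \<omega>' \<in> a"
        by (rule J(3)[rule_format]) (use * eq in auto)
      with * show "\<omega> \<in> (I \<rightarrow>\<^sub>E UNIV) - a \<longleftrightarrow> \<omega>' \<in> (I \<rightarrow>\<^sub>E UNIV) - a" by (simp only: Diff_iff)
    qed (fact J)+
  next
    case (Union a)
    let ?Q = "\<lambda>J A. J \<subseteq> I \<and> countable J \<and>
        (\<forall>\<omega>\<in>I \<rightarrow>\<^sub>E UNIV. \<forall>\<omega>'\<in>I \<rightarrow>\<^sub>E UNIV. (\<forall>i\<in>J. \<omega> i = \<omega>' i) \<longrightarrow> (\<omega> \<in> A \<longleftrightarrow> \<omega>' \<in> A))"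
    have "\<forall>n. \<exists>J. ?Q J (a n)" by (rule allI) (rule Union.IH)
    from choice[OF this] obtain J where J: "\<forall>n. ?Q (J n) (a n)" by (elim exE)
    show ?case
    proof (intro exI[of _ "\<Union>n. J n"] conjI ballI impI)
      fix \<omega> \<omega>' :: "'a \<Rightarrow> bool" assume *: "\<omega> \<in> I \<rightarrow>\<^sub>E UNIV" "\<omega>' \<in> I \<rightarrow>\<^sub>E UNIV" "\<forall>i\<in>\<Union>n. J n. \<omega> i = \<omega>' i"
      have "\<omega> \<in> a n \<longleftrightarrow> \<omega>' \<in> a n" for n
        by (rule J[rule_format, THEN conjunct2, THEN conjunct2, rule_format]) (use * in auto)
      then show "\<omega> \<in> (\<Union>n. a n) \<longleftrightarrow> \<omega>' \<in> (\<Union>n. a n)" by simp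
    next
      show "(\<Union>n. J n) \<subseteq> I" using J by blast
      show "countable (\<Union>n. J n)" using J by simp
    qed
  qed
qed

section \<open>Connections in a configuration\<close>

text \<open>Connection by edges of \<open>\<eta>\<close>, as a reflexive and transitive relation on the vertices.\<close>
definition reach :: "'a set set \<Rightarrow> ('a \<times> 'a) set" where
  "reach \<eta> = {(x, y). {x, y} \<in> \<eta>}\<^sup>*"

lemma reach_refl [simp]: "(x, x) \<in> reach \<eta>"
  by (simp add: reach_def)

lemma reach_trans: "(x, y) \<in> reach \<eta> \<Longrightarrow> (y, z) \<in> reach \<eta> \<Longrightarrow> (x, z) \<in> reach \<eta>"
  unfolding reach_def by (rule rtrancl_trans)

lemma reach_edge: "{x, y} \<in> \<eta> \<Longrightarrow> (x, y) \<in> reach \<eta>"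
  unfolding reach_def by auto

lemma reach_step: "(x, y) \<in> reach \<eta> \<Longrightarrow> {y, z} \<in> \<eta> \<Longrightarrow> (x, z) \<in> reach \<eta>"
  using reach_trans reach_edge by metis

lemma reach_induct [consumes 1, case_names refl step]:
  assumes "(x, y) \<in> reach \<eta>" and "P x"
    and "\<And>y z. (x, y) \<in> reach \<eta> \<Longrightarrow> {y, z} \<in> \<eta> \<Longrightarrow> P y \<Longrightarrow> P z"
  shows "P y"
  using assms(1) unfolding reach_def
proof (induction rule: rtrancl_induct)
  case (step y z)
  then show ?case using assms(3) by (auto simp: reach_def)
qed (rule assms(2))

lemma reach_sym: "(x, y) \<in> reach \<eta> \<Longrightarrow> (y, x) \<in> reach \<eta>"
proof (induction rule: reach_induct)
  case (step y z)
  then have "(z, y) \<in> reach \<eta>" by (metis insert_commute reach_edge)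
  then show ?case using step reach_trans by metis
qed simp

lemma reach_mono: "\<eta> \<subseteq> \<eta>' \<Longrightarrow> reach \<eta> \<subseteq> reach \<eta>'"
  unfolding reach_def by (intro rtrancl_mono) auto

lemma reach_endpoint: "(x, y) \<in> reach \<eta> \<Longrightarrow> y = x \<or> y \<in> \<Union>\<eta>"
  by (induction rule: reach_induct) auto

lemma reach_UN_incseq:
  assumes "incseq \<eta>"
  shows "(x, y) \<in> reach (\<Union>n. \<eta> n) \<longleftrightarrow> (\<exists>n::nat. (x, y) \<in> reach (\<eta> n))"
proof
  assume "(x, y) \<in> reach (\<Union>n. \<eta> n)"
  then show "\<exists>n. (x, y) \<in> reach (\<eta> n)"
  proof (induction rule: reach_induct)
    case (step y z)
    then obtain n m where "(x, y) \<in> reach (\<eta> n)" "{y, z} \<in> \<eta> m" by auto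
    then have "(x, y) \<in> reach (\<eta> (max n m))" "{y, z} \<in> \<eta> (max n m)"
      using reach_mono[OF incseqD[OF assms, of n "max n m"]] incseqD[OF assms, of m "max n m"] by auto
    then show ?case using reach_step by metis
  qed auto
next
  assume "\<exists>n. (x, y) \<in> reach (\<eta> n)"
  then show "(x, y) \<in> reach (\<Union>n. \<eta> n)"
    using reach_mono[of "\<eta> _" "\<Union>n. \<eta> n"] by blast
qed

text \<open>For the set \<open>T\<close> of interior vertices of a block of edges: every connection in \<open>\<eta>\<close> between
  vertices outside \<open>T\<close> is also one in \<open>\<eta>'\<close>.\<close>
definition connects_less :: "'a set \<Rightarrow> 'a set set \<Rightarrow> 'a set set \<Rightarrow> bool" where
  "connects_less T \<eta> \<eta>' \<longleftrightarrow>
     (\<forall>c y. c \<notin> T \<longrightarrow> y \<notin> T \<longrightarrow> (c, y) \<in> reach \<eta> \<longrightarrow> (c, y) \<in> reach \<eta>')"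

lemma connects_less_mono: "\<eta> \<subseteq> \<eta>' \<Longrightarrow> connects_less T \<eta> \<eta>'"
  unfolding connects_less_def using reach_mono by blast

text \<open>Replacing the configuration inside a block by one that connects more of its outer vertices
  can only create connections between vertices that are not interior to the block.\<close>
lemma reach_replace_block:
  assumes "(a, b) \<in> reach (\<zeta> \<union> \<eta>)" and "connects_less T \<eta> \<eta>'"
    and "\<And>e. e \<in> \<zeta> \<Longrightarrow> e \<inter> T = {}" and "a \<notin> T" "b \<notin> T"
  shows "(a, b) \<in> reach (\<zeta> \<union> \<eta>')"
proof -
  have into: "(c, y) \<in> reach \<eta>'" if "c \<notin> T" "y \<notin> T" "(c, y) \<in> reach \<eta>" for c y
    using assms(2) that unfolding connects_less_def by blast
  have up: "reach \<eta>' \<subseteq> reach (\<zeta> \<union> \<eta>')" by (rule reach_mono) simp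
  \<comment> \<open>The last piece of a path, inside the block, is kept in \<open>\<eta>\<close> until the path leaves \<open>T\<close>.\<close>
  have "\<exists>c. c \<notin> T \<and> (a, c) \<in> reach (\<zeta> \<union> \<eta>') \<and> (c, b) \<in> reach \<eta>"
    using assms(1)
  proof (induction rule: reach_induct)
    case refl
    then show ?case using assms(4) by (intro exI[of _ a]) simp
  next
    case (step y z)
    then obtain c where c: "c \<notin> T" "(a, c) \<in> reach (\<zeta> \<union> \<eta>')" "(c, y) \<in> reach \<eta>" by auto
    show ?case
    proof (cases "{y, z} \<in> \<eta>")
      case True
      then show ?thesis using c reach_step[OF c(3) True] by blast
    next
      case False
      then have e: "{y, z} \<in> \<zeta>" using step by auto
      then have yz: "y \<notin> T" "z \<notin> T" using assms(3)[OF e] by auto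
      have "(a, y) \<in> reach (\<zeta> \<union> \<eta>')" 
        by (rule reach_trans[OF c(2)]) (use into[OF c(1) yz(1) c(3)] up in blast)
      then have "(a, z) \<in> reach (\<zeta> \<union> \<eta>')" by (rule reach_step) (use e in simp)
      then show ?thesis using yz by auto
    qed
  qed
  then obtain c where "c \<notin> T" "(a, c) \<in> reach (\<zeta> \<union> \<eta>')" "(c, b) \<in> reach \<eta>" by auto
  then show ?thesis using into[of c b] assms(5) up reach_trans[of a c _ b] by blast
qed

section \<open>Exchanging the parameters block by block\<close>

text \<open>Passing from the parameters \<open>\<rho>\<close> to \<open>\<rho>'\<close> on the block \<open>B\<close> does not decrease the expectation
  of any function that respects the connections between the outer vertices.\<close>
definition block_dominated ::
    "('a set \<Rightarrow> real) \<Rightarrow> ('a set \<Rightarrow> real) \<Rightarrow> 'a set \<Rightarrow> 'a set set \<Rightarrow> bool" where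
  "block_dominated \<rho> \<rho>' T B \<longleftrightarrow>
     (\<forall>g. (\<forall>\<eta> \<eta>'. \<eta> \<subseteq> B \<longrightarrow> \<eta>' \<subseteq> B \<longrightarrow> connects_less T \<eta> \<eta>' \<longrightarrow> g \<eta> \<le> g \<eta>') \<longrightarrow>
        bern_expect \<rho> B g \<le> bern_expect \<rho>' B g)"

text \<open>Conditionally on the configuration outside a block, the integrand respects connections, so the
  blocks can be exchanged one after the other.\<close>
lemma bern_expect_le_of_blocks:
  assumes "finite \<C>" "\<And>B. B \<in> \<C> \<Longrightarrow> finite B" "disjoint \<C>"
    and "\<And>e. e \<in> \<Union>\<C> \<Longrightarrow> 0 \<le> \<rho> e \<and> \<rho> e \<le> 1" "\<And>e. e \<in> \<Union>\<C> \<Longrightarrow> 0 \<le> \<rho>' e \<and> \<rho>' e \<le> 1"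
    and "\<And>B. B \<in> \<C> \<Longrightarrow> block_dominated \<rho> \<rho>' (T B) B"
    and "\<And>B \<zeta> \<eta> \<eta>'. B \<in> \<C> \<Longrightarrow> \<zeta> \<subseteq> \<Union>\<C> - B \<Longrightarrow> \<eta> \<subseteq> B \<Longrightarrow> \<eta>' \<subseteq> B \<Longrightarrow>
           connects_less (T B) \<eta> \<eta>' \<Longrightarrow> g (\<zeta> \<union> \<eta>) \<le> g (\<zeta> \<union> \<eta>')"
  shows "bern_expect \<rho> (\<Union>\<C>) g \<le> bern_expect \<rho>' (\<Union>\<C>) g"
  using assms
proof (induction \<C> arbitrary: g rule: finite_induct)
  case (insert B \<C>)
  have d: "\<Union>\<C> \<inter> B = {}"
    using insert.hyps insert.prems(2) by (auto simp: disjoint_def)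
  have fin: "finite (\<Union>\<C>)" "finite B" using insert.hyps insert.prems(1) by auto
  have un: "\<Union>(insert B \<C>) = \<Union>\<C> \<union> B" by auto
  let ?g = "\<lambda>\<zeta>. bern_expect \<rho>' B (\<lambda>\<eta>. g (\<zeta> \<union> \<eta>))"
  have "bern_expect \<rho> (\<Union>(insert B \<C>)) g = bern_expect \<rho> (\<Union>\<C>) (\<lambda>\<zeta>. bern_expect \<rho> B (\<lambda>\<eta>. g (\<zeta> \<union> \<eta>)))"
    unfolding un by (rule bern_expect_split) (use fin d in auto)
  also have "\<dots> \<le> bern_expect \<rho> (\<Union>\<C>) ?g"
  proof (rule bern_expect_mono)
    fix \<zeta> assume z: "\<zeta> \<subseteq> \<Union>\<C>"
    have "g (\<zeta> \<union> \<eta>) \<le> g (\<zeta> \<union> \<eta>')" if "\<eta> \<subseteq> B" "\<eta>' \<subseteq> B" "connects_less (T B) \<eta> \<eta>'" for \<eta> \<eta>'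
      by (rule insert.prems(6)[of B]) (use that z d in auto)
    then show "bern_expect \<rho> B (\<lambda>\<eta>. g (\<zeta> \<union> \<eta>)) \<le> ?g \<zeta>"
      using insert.prems(5)[of B] unfolding block_dominated_def by simp
  qed (use insert.prems(3) in auto)
  also have "\<dots> \<le> bern_expect \<rho>' (\<Union>\<C>) ?g"
  proof (rule insert.IH)
    show "disjoint \<C>" using insert.prems(2) by (auto simp: disjoint_def)
    fix B' \<zeta> \<eta> \<eta>' assume a: "B' \<in> \<C>" "\<zeta> \<subseteq> \<Union>\<C> - B'" "\<eta> \<subseteq> B'" "\<eta>' \<subseteq> B'" "connects_less (T B') \<eta> \<eta>'"
    show "?g (\<zeta> \<union> \<eta>) \<le> ?g (\<zeta> \<union> \<eta>')"
    proof (rule bern_expect_mono)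
      fix \<xi> assume x: "\<xi> \<subseteq> B"
      have "g ((\<zeta> \<union> \<xi>) \<union> \<eta>) \<le> g ((\<zeta> \<union> \<xi>) \<union> \<eta>')"
        by (rule insert.prems(6)[of B']) (use a x d in auto)
      then show "g (\<zeta> \<union> \<eta> \<union> \<xi>) \<le> g (\<zeta> \<union> \<eta>' \<union> \<xi>)" by (simp add: Un_ac)
    qed (use insert.prems(4) in auto)
  qed (use insert.prems in auto)
  also have "\<dots> = bern_expect \<rho>' (\<Union>(insert B \<C>)) g"
    unfolding un by (rule bern_expect_split[symmetric]) (use fin d in auto)
  finally show ?case .
qed simp

text \<open>The blocks are the fibres of \<open>\<kappa>\<close>, and \<open>N\<close> avoids their interiors. The
  event that \<open>x\<close> is connected to infinitely many vertices of \<open>N\<close> is approximated by events that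
  depend on finitely many blocks.\<close>
lemma infinite_reach_comparison:
  fixes I :: "'a set set" and \<kappa> :: "'a set \<Rightarrow> 'k"
  defines "Ev \<equiv> \<lambda>N x. {\<omega> \<in> I \<rightarrow>\<^sub>E UNIV. infinite {y \<in> N. (x, y) \<in> reach {e \<in> I. \<omega> e}}}"
  assumes cI: "countable I" and fin: "\<And>e. e \<in> I \<Longrightarrow> finite e"
    and finB: "\<And>k. finite {e \<in> I. \<kappa> e = k}"
    and \<rho>: "\<And>e. e \<in> I \<Longrightarrow> 0 \<le> \<rho> e \<and> \<rho> e \<le> 1" and \<rho>': "\<And>e. e \<in> I \<Longrightarrow> 0 \<le> \<rho>' e \<and> \<rho>' e \<le> 1"
    and T: "\<And>e k. e \<in> I \<Longrightarrow> e \<inter> T k \<noteq> {} \<Longrightarrow> \<kappa> e = k" and N: "\<And>k. N \<inter> T k = {}"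
    and dom: "\<And>k. k \<in> \<kappa> ` I \<Longrightarrow> block_dominated \<rho> \<rho>' (T k) {e \<in> I. \<kappa> e = k}"
    and x: "x \<in> N"
  shows "Ev N x \<in> sets (bern_product \<rho> I)"
    and "measure (bern_product \<rho> I) (Ev N x) \<le> measure (bern_product \<rho>' I) (Ev N x)"
proof -
  obtain f :: "nat \<Rightarrow> 'k" where f: "\<kappa> ` I \<subseteq> range f"
    using cI by (metis countable_image empty_subsetI range_from_nat_into subset_refl)
  \<comment> \<open>\<open>J n\<close> is the union of the first \<open>n\<close> blocks in some enumeration.\<close>
  define J where "J n = {e \<in> I. \<kappa> e \<in> f ` {..<n}}" for n
  have Jfin: "finite (J n)" for n
  proof -
    have "J n = (\<Union>i<n. {e \<in> I. \<kappa> e = f i})" by (auto simp: J_def)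
    then show ?thesis using finB by simp
  qed
  have JI: "J n \<subseteq> I" for n by (auto simp: J_def)
  have JU: "(\<Union>n. J n) = I"
  proof -
    have "\<exists>n. e \<in> J n" if "e \<in> I" for e
    proof -
      obtain i where "\<kappa> e = f i" using f \<open>e \<in> I\<close> by auto
      then show ?thesis using \<open>e \<in> I\<close> by (intro exI[of _ "Suc i"]) (auto simp: J_def)
    qed
    then show ?thesis using JI by blast
  qed
  have Jinc: "incseq J" by (auto simp: J_def incseq_def)
  define H where "H \<eta> = {y \<in> N. (x, y) \<in> reach \<eta>}" for \<eta>
  have Hfin: "finite (H \<eta>)" if "\<eta> \<subseteq> J n" for \<eta> n
  proof (rule finite_subset)
    show "H \<eta> \<subseteq> insert x (\<Union>\<eta>)" unfolding H_def using reach_endpoint by fastforce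
    have "finite \<eta>" "\<And>e. e \<in> \<eta> \<Longrightarrow> finite e"
      using that Jfin[of n] finite_subset JI[of n] fin by blast+
    then show "finite (insert x (\<Union>\<eta>))" by simp
  qed
  have Hmono: "H \<eta> \<subseteq> H \<eta>'" if "\<eta> \<subseteq> \<eta>'" for \<eta> \<eta>'
    unfolding H_def using reach_mono[OF that] by auto
  define D where "D k = {\<eta>. k \<le> card (H \<eta>)}" for k
  define X where "X k n = {\<omega> \<in> I \<rightarrow>\<^sub>E UNIV. {e \<in> J n. \<omega> e} \<in> D k}" for k n
  define Y where "Y k = (\<Union>n. X k n)" for k
  have Xinc: "incseq (X k)" for k
  proof (intro incseq_SucI subsetI)
    fix n \<omega> assume "\<omega> \<in> X k n"
    moreover have "{e \<in> J n. \<omega> e} \<subseteq> {e \<in> J (Suc n). \<omega> e}" using incseq_SucD[OF Jinc, of n] by auto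
    then have "card (H {e \<in> J n. \<omega> e}) \<le> card (H {e \<in> J (Suc n). \<omega> e})"
      by (intro card_mono Hfin[of _ "Suc n"] Hmono) auto
    ultimately show "\<omega> \<in> X k (Suc n)" by (auto simp: X_def D_def)
  qed
  have Ydec: "decseq Y"
    by (intro decseq_SucI) (auto simp: Y_def X_def D_def)
  have Ev: "Ev N x = (\<Inter>k. Y k)"
  proof -
    have "infinite (H {e \<in> I. \<omega> e}) \<longleftrightarrow> (\<forall>k. \<exists>n. k \<le> card (H {e \<in> J n. \<omega> e}))" for \<omega>
    proof -
      define h where "h n = H {e \<in> J n. \<omega> e}" for n
      have inc: "incseq (\<lambda>n. {e \<in> J n. \<omega> e})" using Jinc by (auto simp: incseq_def)
      have "{e \<in> I. \<omega> e} = (\<Union>n. {e \<in> J n. \<omega> e})" using JU by auto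
      then have HU: "H {e \<in> I. \<omega> e} = (\<Union>n. h n)"
        unfolding H_def h_def using reach_UN_incseq[OF inc] by auto
      have hf: "finite (h n)" for n unfolding h_def by (rule Hfin[of _ n]) auto
      have hinc: "incseq h" unfolding incseq_def h_def using inc by (auto simp: incseq_def intro!: Hmono)
      show ?thesis unfolding HU h_def[symmetric]
      proof
        assume inf: "infinite (\<Union>n. h n)"
        show "\<forall>k. \<exists>n. k \<le> card (h n)"
        proof
          fix k
          obtain A where A: "A \<subseteq> (\<Union>n. h n)" "finite A" "card A = k"
            using infinite_arbitrarily_large[OF inf] by blast
          have "\<exists>n. A \<subseteq> h n" using A(2,1)
          proof (induction A rule: finite_induct)
            case (insert a A)
            then obtain n m where "A \<subseteq> h n" "a \<in> h m" by auto
            then show ?case using incseqD[OF hinc, of n "max n m"] incseqD[OF hinc, of m "max n m"]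
              by (intro exI[of _ "max n m"]) auto
          qed simp
          then obtain n where "A \<subseteq> h n" by auto
          then show "\<exists>n. k \<le> card (h n)" using card_mono[OF hf, of A n] A(3) by auto
        qed
      next
        assume *: "\<forall>k. \<exists>n. k \<le> card (h n)"
        show "infinite (\<Union>n. h n)"
        proof
          assume fin: "finite (\<Union>n. h n)"
          obtain n where "Suc (card (\<Union>n. h n)) \<le> card (h n)" using * by blast
          moreover have "card (h n) \<le> card (\<Union>n. h n)" by (rule card_mono[OF fin]) auto
          ultimately show False by simp
        qed
      qed
    qed
    then show ?thesis by (auto simp: Ev_def Y_def X_def D_def H_def)
  qed
  have Xs: "X k n \<in> sets (bern_product \<sigma> I)"
    and Xm: "measure (bern_product \<sigma> I) (X k n) = bern_expect \<sigma> (J n) (indicator (D k))"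
    if "\<And>e. e \<in> I \<Longrightarrow> 0 \<le> \<sigma> e \<and> \<sigma> e \<le> 1" for \<sigma> k n
  proof -
    have *: "\<And>e. e \<in> J n \<Longrightarrow> 0 \<le> \<sigma> e \<and> \<sigma> e \<le> 1" using that JI by auto
    show "X k n \<in> sets (bern_product \<sigma> I)" unfolding X_def
      by (rule bern_product_cylinder(1)[OF Jfin JI *])
    show "measure (bern_product \<sigma> I) (X k n) = bern_expect \<sigma> (J n) (indicator (D k))" unfolding X_def
      by (rule bern_product_cylinder(2)[OF Jfin JI *])
  qed
  have Xle: "measure (bern_product \<rho> I) (X k n) \<le> measure (bern_product \<rho>' I) (X k n)" for k n
  proof -
    define \<C> where "\<C> = (\<lambda>k. {e \<in> I. \<kappa> e = k}) ` (f ` {..<n} \<inter> \<kappa> ` I)"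
    have J\<C>: "J n = \<Union>\<C>" unfolding J_def \<C>_def by auto
    have "bern_expect \<rho> (\<Union>\<C>) (indicator (D k)) \<le> bern_expect \<rho>' (\<Union>\<C>) (indicator (D k))"
    \<comment> \<open>The interior of a block is recovered from the key of any of its edges.\<close>
    proof (rule bern_expect_le_of_blocks[where T = "\<lambda>B. T (\<kappa> (SOME e. e \<in> B))"])
      have key: "\<kappa> (SOME e. e \<in> B) \<in> \<kappa> ` I \<and> B = {e \<in> I. \<kappa> e = \<kappa> (SOME e. e \<in> B)}" if "B \<in> \<C>" for B
      proof -
        from that[unfolded \<C>_def] obtain j where j: "B = {e \<in> I. \<kappa> e = j}" "j \<in> f ` {..<n} \<inter> \<kappa> ` I"
          by (rule imageE)
        then obtain e where "e \<in> B" by auto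
        then have "(SOME e. e \<in> B) \<in> B" by (rule someI)
        then show ?thesis using j by simp
      qed
      show "finite \<C>" unfolding \<C>_def by simp
      show "finite B" if "B \<in> \<C>" for B using that finB by (auto simp: \<C>_def)
      show "disjoint \<C>" unfolding \<C>_def disjoint_def by auto
      show "0 \<le> \<rho> e \<and> \<rho> e \<le> 1" if "e \<in> \<Union>\<C>" for e using that \<rho> by (auto simp: \<C>_def)
      show "0 \<le> \<rho>' e \<and> \<rho>' e \<le> 1" if "e \<in> \<Union>\<C>" for e using that \<rho>' by (auto simp: \<C>_def)
      show "block_dominated \<rho> \<rho>' (T (\<kappa> (SOME e. e \<in> B))) B" if "B \<in> \<C>" for B
        using key[OF that] dom by metis
      fix B \<zeta> \<eta> \<eta>' assume B: "B \<in> \<C>" and z: "\<zeta> \<subseteq> \<Union>\<C> - B" and e: "\<eta> \<subseteq> B" "\<eta>' \<subseteq> B"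
        and c: "connects_less (T (\<kappa> (SOME e. e \<in> B))) \<eta> \<eta>'"
      have t: "e \<inter> T (\<kappa> (SOME e. e \<in> B)) = {}" if "e \<in> \<zeta>" for e
      proof (rule ccontr)
        have eI: "e \<in> I" "e \<notin> B" using that z J\<C> JI[of n] by auto
        assume "\<not> ?thesis"
        then have "\<kappa> e = \<kappa> (SOME e. e \<in> B)" using T eI by blast
        then show False using key[OF B] eI by auto
      qed
      have "H (\<zeta> \<union> \<eta>) \<subseteq> H (\<zeta> \<union> \<eta>')"
        unfolding H_def using reach_replace_block[OF _ c t] N x by blast
      moreover have "finite (H (\<zeta> \<union> \<eta>'))"
        by (rule Hfin[of _ n]) (use z e B J\<C> in auto)
      ultimately have "card (H (\<zeta> \<union> \<eta>)) \<le> card (H (\<zeta> \<union> \<eta>'))" by (intro card_mono)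
      then show "indicator (D k) (\<zeta> \<union> \<eta>) \<le> (indicator (D k) (\<zeta> \<union> \<eta>') :: real)"
        by (auto simp: D_def indicator_def)
    qed
    moreover have "measure (bern_product \<rho> I) (X k n) = bern_expect \<rho> (\<Union>\<C>) (indicator (D k))"
      unfolding J\<C>[symmetric] by (rule Xm) (rule \<rho>)
    moreover have "measure (bern_product \<rho>' I) (X k n) = bern_expect \<rho>' (\<Union>\<C>) (indicator (D k))"
      unfolding J\<C>[symmetric] by (rule Xm) (rule \<rho>')
    ultimately show ?thesis by simp
  qed
  interpret P: prob_space "bern_product \<rho> I" by (rule prob_space_bern_product)
  interpret P': prob_space "bern_product \<rho>' I" by (rule prob_space_bern_product)
  have Ys: "Y k \<in> P.events" "Y k \<in> P'.events" for k
    unfolding Y_def using Xs[OF \<rho>] Xs[OF \<rho>'] by auto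
  show "Ev N x \<in> sets (bern_product \<rho> I)" unfolding Ev using Ys by auto
  have Yle: "P.prob (Y k) \<le> P'.prob (Y k)" for k
  proof (rule LIMSEQ_le)
    show "(\<lambda>n. P.prob (X k n)) \<longlonglongrightarrow> P.prob (Y k)" unfolding Y_def
      by (rule P.finite_Lim_measure_incseq) (use Xs[OF \<rho>] Xinc in auto)
    show "(\<lambda>n. P'.prob (X k n)) \<longlonglongrightarrow> P'.prob (Y k)" unfolding Y_def
      by (rule P'.finite_Lim_measure_incseq) (use Xs[OF \<rho>'] Xinc in auto)
  qed (use Xle in auto)
  show "P.prob (Ev N x) \<le> P'.prob (Ev N x)"
  proof (rule LIMSEQ_le)
    show "(\<lambda>k. P.prob (Y k)) \<longlonglongrightarrow> P.prob (Ev N x)" unfolding Ev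
      by (rule P.finite_Lim_measure_decseq) (use Ys Ydec in auto)
    show "(\<lambda>k. P'.prob (Y k)) \<longlonglongrightarrow> P'.prob (Ev N x)" unfolding Ev
      by (rule P'.finite_Lim_measure_decseq) (use Ys Ydec in auto)
  qed (use Yle in auto)
qed

text \<open>The quantitative heart of the proof. The block \<open>B\<close> consists of column edges \<open>Q\<close>, whose
  parameters change by at most \<open>\<epsilon>\<close> in an arbitrary direction, and of edges \<open>P\<close> whose parameters
  grow by at least \<open>d\<close>. If some column configuration \<open>\<eta>\<close> connects no outer vertices on its own,
  but as much as the full block when the edges of \<open>P\<close> are added, then the growth on \<open>P\<close> wins.\<close>
lemma block_dominatedI:
  fixes P Q :: "'a set set" and d \<delta> \<epsilon> :: real
  assumes fin: "finite P" "finite Q" and disj: "Q \<inter> P = {}" and card: "card (Q \<union> P) \<le> n"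
    and d: "0 < d" "d \<le> 1" and \<delta>: "0 < \<delta>" "\<delta> \<le> 1" and \<epsilon>: "0 \<le> \<epsilon>" "real n * \<epsilon> \<le> (\<delta> * d) ^ n"
    and P: "\<And>e. e \<in> P \<Longrightarrow> 0 \<le> \<rho> e \<and> \<rho> e + d \<le> \<rho>' e \<and> \<rho>' e \<le> 1"
    and Q: "\<And>e. e \<in> Q \<Longrightarrow> 0 \<le> \<rho> e \<and> \<rho> e \<le> 1 \<and> \<delta> \<le> \<rho>' e \<and> \<rho>' e \<le> 1 - \<delta> \<and> \<bar>\<rho> e - \<rho>' e\<bar> \<le> \<epsilon>"
    and \<eta>: "\<eta> \<subseteq> Q" "connects_less T \<eta> {}" "connects_less T (Q \<union> P) (\<eta> \<union> P)"
  shows "block_dominated \<rho> \<rho>' T (Q \<union> P)"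
  unfolding block_dominated_def
proof (intro allI impI)
  fix g :: "'a set set \<Rightarrow> real"
  assume "\<forall>\<eta> \<eta>'. \<eta> \<subseteq> Q \<union> P \<longrightarrow> \<eta>' \<subseteq> Q \<union> P \<longrightarrow> connects_less T \<eta> \<eta>' \<longrightarrow> g \<eta> \<le> g \<eta>'"
  then have g: "g \<eta> \<le> g \<eta>'" if "\<eta> \<subseteq> Q \<union> P" "\<eta>' \<subseteq> Q \<union> P" "connects_less T \<eta> \<eta>'" for \<eta> \<eta>'
    using that by blast
  define osc where "osc = g (Q \<union> P) - g {}"
  have gb: "g {} \<le> g \<xi> \<and> g \<xi> \<le> g (Q \<union> P)" if "\<xi> \<subseteq> Q \<union> P" for \<xi>
    using that by (intro conjI g connects_less_mono) auto
  then have osc0: "0 \<le> osc" unfolding osc_def using gb[of "{}"] by simp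
  \<comment> \<open>First the column parameters change, then those on \<open>P\<close>.\<close>
  define \<sigma> where "\<sigma> e = (if e \<in> P then \<rho> e else \<rho>' e)" for e
  have \<rho>01: "0 \<le> \<rho> e \<and> \<rho> e \<le> 1" if "e \<in> Q \<union> P" for e using that P[of e] Q[of e] d(1) by auto
  have \<rho>'01: "0 \<le> \<rho>' e \<and> \<rho>' e \<le> 1" if "e \<in> Q \<union> P" for e
    using that P[of e] Q[of e] d(1) \<delta>(1) by auto
  have \<sigma>01: "0 \<le> \<sigma> e \<and> \<sigma> e \<le> 1" if "e \<in> Q \<union> P" for e
    using that \<rho>01[OF that] \<rho>'01[OF that] unfolding \<sigma>_def by auto
  have "(\<Sum>e\<in>Q \<union> P. \<bar>\<rho> e - \<sigma> e\<bar>) \<le> (\<Sum>e\<in>Q \<union> P. \<epsilon>)"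
    by (rule sum_mono) (use \<epsilon>(1) Q in \<open>auto simp: \<sigma>_def\<close>)
  also have "\<dots> \<le> n * \<epsilon>" using card \<epsilon>(1) by (simp add: mult_right_mono)
  finally have s: "(\<Sum>e\<in>Q \<union> P. \<bar>\<rho> e - \<sigma> e\<bar>) \<le> (\<delta> * d) ^ n" using \<epsilon>(2) by linarith
  have "bern_expect \<rho> (Q \<union> P) g - bern_expect \<sigma> (Q \<union> P) g \<le> (\<Sum>e\<in>Q \<union> P. \<bar>\<rho> e - \<sigma> e\<bar>) * osc"
    unfolding osc_def by (rule bern_expect_lipschitz) (use fin \<rho>01 \<sigma>01 gb in auto)
  also have "\<dots> \<le> (\<delta> * d) ^ n * osc" using s osc0 by (rule mult_right_mono)
  finally have loss: "bern_expect \<rho> (Q \<union> P) g - bern_expect \<sigma> (Q \<union> P) g \<le> (\<delta> * d) ^ n * osc" .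
  define G where "G \<tau> \<zeta> = bern_expect \<tau> P (\<lambda>\<xi>. g (\<zeta> \<union> \<xi>))" for \<tau> \<zeta>
  have split: "bern_expect \<tau> (Q \<union> P) g = bern_expect \<tau> Q (G \<tau>)" for \<tau>
    unfolding G_def by (rule bern_expect_split) (use fin disj in auto)
  have gain: "(\<Prod>e\<in>P. \<rho>' e - \<sigma> e) * (g (\<zeta> \<union> P) - g \<zeta>) \<le> G \<rho>' \<zeta> - G \<sigma> \<zeta>" if "\<zeta> \<subseteq> Q" for \<zeta>
  proof -
    have "(\<Prod>e\<in>P. \<rho>' e - \<sigma> e) * (g (\<zeta> \<union> P) - g (\<zeta> \<union> {})) \<le> G \<rho>' \<zeta> - G \<sigma> \<zeta>"
      unfolding G_def
    proof (rule bern_expect_gain[OF fin(1)])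
      show "0 \<le> \<sigma> e \<and> \<sigma> e \<le> \<rho>' e \<and> \<rho>' e \<le> 1" if "e \<in> P" for e
        using P[OF that] that d(1) by (auto simp: \<sigma>_def)
      show "g (\<zeta> \<union> \<xi>) \<le> g (\<zeta> \<union> \<xi>')" if "\<xi> \<subseteq> \<xi>'" "\<xi>' \<subseteq> P" for \<xi> \<xi>'
        using that \<open>\<zeta> \<subseteq> Q\<close> by (intro g connects_less_mono) auto
    qed
    then show ?thesis by simp
  qed
  have prod0: "d ^ card P \<le> (\<Prod>e\<in>P. \<rho>' e - \<sigma> e)"
  proof -
    have "(\<Prod>e\<in>P. d) \<le> (\<Prod>e\<in>P. \<rho>' e - \<sigma> e)"
      by (rule prod_mono) (use P d in \<open>force simp: \<sigma>_def\<close>)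
    then show ?thesis by simp
  qed
  have gainpos: "0 \<le> G \<rho>' \<zeta> - G \<sigma> \<zeta>" if "\<zeta> \<subseteq> Q" for \<zeta>
  proof -
    have "0 \<le> (\<Prod>e\<in>P. \<rho>' e - \<sigma> e)" using prod0 d by (meson order_trans zero_le_power less_imp_le)
    moreover have "g \<zeta> \<le> g (\<zeta> \<union> P)" using that by (intro g connects_less_mono) auto
    ultimately have "0 \<le> (\<Prod>e\<in>P. \<rho>' e - \<sigma> e) * (g (\<zeta> \<union> P) - g \<zeta>)" by simp
    then show ?thesis using gain[OF that] by linarith
  qed
  have w0: "0 \<le> bern_weight \<rho>' Q \<zeta>" for \<zeta> by (rule bern_weight_nonneg) (use \<rho>'01 in auto)
  have w: "\<delta> ^ card Q \<le> bern_weight \<rho>' Q \<eta>"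
  proof -
    have "(\<Prod>e\<in>Q. \<delta>) \<le> bern_weight \<rho>' Q \<eta>" unfolding bern_weight_def
      by (rule prod_mono) (use Q \<delta>(1) in force)
    then show ?thesis by simp
  qed
  have "bern_expect \<sigma> Q (G \<sigma>) = bern_expect \<rho>' Q (G \<sigma>)"
    unfolding bern_expect_def bern_weight_def
    by (intro sum.cong refl arg_cong2[where f="(*)"] prod.cong) (use disj in \<open>auto simp: \<sigma>_def\<close>)
  then have eq: "bern_expect \<rho>' (Q \<union> P) g - bern_expect \<sigma> (Q \<union> P) g =
      (\<Sum>\<zeta>\<in>Pow Q. bern_weight \<rho>' Q \<zeta> * (G \<rho>' \<zeta> - G \<sigma> \<zeta>))"
    unfolding split by (simp add: bern_expect_def sum_subtractf algebra_simps)
  \<comment> \<open>At the column configuration \<open>\<eta>\<close> the edges of \<open>P\<close> decide over the whole oscillation.\<close>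
  have full: "g (\<eta> \<union> P) - g \<eta> \<ge> osc"
  proof -
    have "g (Q \<union> P) \<le> g (\<eta> \<union> P)" "g \<eta> \<le> g {}"
      by (rule g; use \<eta> in auto)+
    then show ?thesis by (simp add: osc_def)
  qed
  have nn: "card Q + card P \<le> n" using card disj fin by (simp add: card_Un_disjoint)
  have "(\<delta> * d) ^ n = \<delta> ^ n * d ^ n" by (rule power_mult_distrib)
  also have "\<dots> \<le> \<delta> ^ card Q * d ^ card P"
    using nn d \<delta> by (intro mult_mono power_decreasing) auto
  finally have pw: "(\<delta> * d) ^ n \<le> \<delta> ^ card Q * d ^ card P" .
  have "(\<delta> * d) ^ n * osc \<le> \<delta> ^ card Q * d ^ card P * osc"
    using pw osc0 by (rule mult_right_mono)
  also have "\<dots> = \<delta> ^ card Q * (d ^ card P * osc)" by simp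
  also have "\<dots> \<le> bern_weight \<rho>' Q \<eta> * ((\<Prod>e\<in>P. \<rho>' e - \<sigma> e) * (g (\<eta> \<union> P) - g \<eta>))"
    using w prod0 full osc0 d \<delta> by (intro mult_mono) (auto intro: mult_nonneg_nonneg order_trans[rotated])
  also have "\<dots> \<le> bern_weight \<rho>' Q \<eta> * (G \<rho>' \<eta> - G \<sigma> \<eta>)"
    using gain[OF \<eta>(1)] w0 by (rule mult_left_mono)
  also have "\<dots> \<le> (\<Sum>\<zeta>\<in>Pow Q. bern_weight \<rho>' Q \<zeta> * (G \<rho>' \<zeta> - G \<sigma> \<zeta>))"
    by (rule member_le_sum) (use \<eta>(1) fin w0 gainpos in auto)
  finally show "bern_expect \<rho> (Q \<union> P) g \<le> bern_expect \<rho>' (Q \<union> P) g"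
    using loss eq by linarith
qed

lemma block_dominated_single:
  assumes "0 \<le> \<rho> e" "\<rho> e \<le> \<rho>' e" "\<rho>' e \<le> 1"
  shows "block_dominated \<rho> \<rho>' T {e}"
  unfolding block_dominated_def
proof (intro allI impI)
  fix g :: "'a set set \<Rightarrow> real"
  assume "\<forall>\<eta> \<eta>'. \<eta> \<subseteq> {e} \<longrightarrow> \<eta>' \<subseteq> {e} \<longrightarrow> connects_less T \<eta> \<eta>' \<longrightarrow> g \<eta> \<le> g \<eta>'"
  then have m: "g \<eta> \<le> g \<eta>'" if "\<eta> \<subseteq> \<eta>'" "\<eta>' \<subseteq> {e}" for \<eta> \<eta>'
    using connects_less_mono[OF that(1)] that by (meson order_trans)
  have "(\<Prod>e\<in>{e}. \<rho>' e - \<rho> e) * (g {e} - g {}) \<le> bern_expect \<rho>' {e} g - bern_expect \<rho> {e} g"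
    by (rule bern_expect_gain) (use assms m in auto)
  moreover have "0 \<le> (\<rho>' e - \<rho> e) * (g {e} - g {})" using assms m[of "{}" "{e}"] by simp
  ultimately show "bern_expect \<rho> {e} g \<le> bern_expect \<rho>' {e} g" by simp
qed

section \<open>Clusters of the ladder graph\<close>

lemma graph_path_iff_reach:
  assumes "\<Union>F \<subseteq> W" "x \<in> W"
  shows "(\<exists>xs. graph_path W F xs \<and> hd xs = x \<and> last xs = y) \<longleftrightarrow> (x, y) \<in> reach F"
proof
  assume "\<exists>xs. graph_path W F xs \<and> hd xs = x \<and> last xs = y"
  then obtain xs where xs: "xs \<noteq> []" "hd xs = x" "last xs = y"
    "\<And>i. Suc i < length xs \<Longrightarrow> {xs ! i, xs ! Suc i} \<in> F"
    by (auto simp: graph_path_def)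
  have "(x, xs ! i) \<in> reach F" if "i < length xs" for i
    using that
  proof (induction i)
    case 0
    then show ?case using xs(1,2) by (simp add: hd_conv_nth)
  next
    case (Suc i)
    then show ?case using xs(4)[of i] by (auto intro: reach_step)
  qed
  then show "(x, y) \<in> reach F" using xs(1,3) by (metis last_conv_nth diff_less length_greater_0_conv zero_less_one)
next
  assume "(x, y) \<in> reach F"
  then show "\<exists>xs. graph_path W F xs \<and> hd xs = x \<and> last xs = y"
  proof (induction rule: reach_induct)
    case refl
    then show ?case using assms(2) by (intro exI[of _ "[x]"]) (auto simp: graph_path_def)
  next
    case (step y z)
    then obtain xs where xs: "graph_path W F xs" "hd xs = x" "last xs = y" by auto
    show ?case
    proof (cases "z \<in> set xs")
      case True
      then obtain i where i: "i < length xs" "xs ! i = z" by (auto simp: in_set_conv_nth)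
      then have "graph_path W F (take (Suc i) xs)"
        using xs(1) set_take_subset[of "Suc i" xs] by (auto simp: graph_path_def)
      moreover have "last (take (Suc i) xs) = z"
        using i by (simp add: take_Suc_conv_app_nth)
      moreover have "hd (take (Suc i) xs) = x" using xs by (cases xs) auto
      ultimately show ?thesis by blast
    next
      case False
      have "{(xs @ [z]) ! i, (xs @ [z]) ! Suc i} \<in> F" if "Suc i < length (xs @ [z])" for i
      proof (cases "Suc i < length xs")
        case True
        then show ?thesis using xs(1) by (auto simp: graph_path_def nth_append)
      next
        case False
        then have "i = length xs - 1" "xs \<noteq> []" using that xs(1) by (auto simp: graph_path_def)
        then have "xs ! i = y" "i < length xs" "Suc i = length xs" using xs(3) by (auto simp: last_conv_nth)
        then show ?thesis using step(2) by (simp add: nth_append)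
      qed
      then have "graph_path W F (xs @ [z])"
        using xs(1) False step(2) assms(1) unfolding graph_path_def by auto
      moreover have "hd (xs @ [z]) = x" using xs by (cases xs) (auto simp: graph_path_def)
      ultimately show ?thesis by (intro exI[of _ "xs @ [z]"]) auto
    qed
  qed
qed

lemma connected_graph_reach:
  assumes "connected_graph V E" "a \<in> V" "b \<in> V"
  shows "(a, b) \<in> reach E"
proof -
  have "\<Union>E \<subseteq> V" using assms(1) by (auto simp: connected_graph_def simple_graph_def)
  then show ?thesis
    using assms graph_path_iff_reach[of E V a b] by (auto simp: connected_graph_def)
qed

lemma ladder_edge_cases [consumes 2, case_names rung vertical]:
  assumes "simple_graph V E" "e \<in> ladder_edges V E"
  obtains (rung) a b h where "{a, b} \<in> E" "a \<noteq> b" "a \<in> V" "b \<in> V" "e = {(a, h), (b, h)}"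
    | (vertical) a h where "a \<in> V" "e = {(a, h), (a, h + 1)}"
proof -
  have "a \<noteq> b \<and> a \<in> V \<and> b \<in> V" if "{a, b} \<in> E" for a b
    using assms(1) that unfolding simple_graph_def by (fastforce simp: doubleton_eq_iff)
  note * = this
  from assms(2) consider a b h where "{a, b} \<in> E" "e = {(a, h), (b, h)}"
    | a h where "a \<in> V" "e = {(a, h), (a, h + 1)}"
    unfolding ladder_edges_def by blast
  then show ?thesis
  proof cases
    case (1 a b h)
    then show ?thesis using *[of a b] by (intro rung) auto
  next
    case (2 a h)
    then show ?thesis by (rule vertical)
  qed
qed

lemma rung_in_ladder_edges: "{a, b} \<in> E \<Longrightarrow> {(a, h), (b, h)} \<in> ladder_edges V E"
  unfolding ladder_edges_def by blast

lemma vertical_in_ladder_edges: "a \<in> V \<Longrightarrow> {(a, h), (a, h + 1)} \<in> ladder_edges V E"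
  unfolding ladder_edges_def by blast

lemma ladder_edge_finite: "e \<in> ladder_edges V E \<Longrightarrow> finite e"
  unfolding ladder_edges_def by auto

lemma ladder_edge_subset:
  assumes "simple_graph V E" "e \<in> ladder_edges V E" shows "e \<subseteq> ladder_verts V"
  using assms by (cases rule: ladder_edge_cases) (auto simp: ladder_verts_def)

lemma countable_ladder_edges:
  assumes "simple_graph V E" "countable V"
  shows "countable (ladder_edges V E)"
proof (rule countable_subset)
  show "ladder_edges V E \<subseteq> (\<lambda>(x, y). {x, y}) ` (ladder_verts V \<times> ladder_verts V)"
  proof
    fix e assume "e \<in> ladder_edges V E"
    with assms(1) show "e \<in> (\<lambda>(x, y). {x, y}) ` (ladder_verts V \<times> ladder_verts V)"
      by (cases rule: ladder_edge_cases) (force simp: ladder_verts_def)+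
  qed
  show "countable ((\<lambda>(x, y). {x, y}) ` (ladder_verts V \<times> ladder_verts V))"
    using assms(2) by (simp add: ladder_verts_def)
qed

lemma open_cluster_eq_reach:
  assumes "simple_graph V E" "x \<in> ladder_verts V"
  shows "open_cluster V E \<omega> x = {y. (x, y) \<in> reach {e \<in> ladder_edges V E. \<omega> e}}"
proof -
  have "\<Union>{e \<in> ladder_edges V E. \<omega> e} \<subseteq> ladder_verts V"
    using ladder_edge_subset[OF assms(1)] by blast
  from graph_path_iff_reach[OF this assms(2)] show ?thesis
    unfolding open_cluster_def open_path_def by auto
qed

lemma infinite_cluster_event_eq:
  assumes "simple_graph V E"
  shows "infinite_cluster_event V E = {\<omega> \<in> ladder_edges V E \<rightarrow>\<^sub>E UNIV.
    \<exists>x\<in>ladder_verts V. infinite {y. (x, y) \<in> reach {e \<in> ladder_edges V E. \<omega> e}}}"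
  unfolding infinite_cluster_event_def using open_cluster_eq_reach[OF assms] by auto

section \<open>Degenerate ladders\<close>

text \<open>For uncountable \<open>V\<close> every countable set of edges misses a whole vertical line; opening this
  line or not decides the event and is not seen by those edges.\<close>
lemma countable_of_measurable_event:
  assumes "simple_graph V E" "infinite_cluster_event V E \<in> sets (bern_product \<rho> (ladder_edges V E))"
  shows "countable V"
proof (rule ccontr)
  assume unc: "uncountable V"
  obtain J where J: "J \<subseteq> ladder_edges V E" "countable J"
    and dep: "\<forall>\<omega>\<in>ladder_edges V E \<rightarrow>\<^sub>E UNIV. \<forall>\<omega>'\<in>ladder_edges V E \<rightarrow>\<^sub>E UNIV.
      (\<forall>i\<in>J. \<omega> i = \<omega>' i) \<longrightarrow>
        (\<omega> \<in> infinite_cluster_event V E \<longleftrightarrow> \<omega>' \<in> infinite_cluster_event V E)"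
    using sets_bern_product_countable_support[OF assms(2)] by blast
  have "countable (fst ` \<Union>J)"
  proof -
    have "countable (\<Union>e\<in>J. e)"
      using J(2)
    proof (rule countable_UN)
      fix e assume "e \<in> J"
      then have "e \<in> ladder_edges V E" using J(1) by auto
      then show "countable e" by (intro countable_finite ladder_edge_finite)
    qed
    then show ?thesis by simp
  qed
  then obtain x where x: "x \<in> V" "x \<notin> fst ` \<Union>J"
    using unc by (metis countable_subset subsetI)
  define line where "line = {{(x, h), (x, h + 1)} | h :: int. True}"
  define \<omega>1 where "\<omega>1 = restrict (\<lambda>e. e \<in> line) (ladder_edges V E)"
  define \<omega>0 where "\<omega>0 = restrict (\<lambda>e. False) (ladder_edges V E)"
  have "\<omega>1 e = \<omega>0 e" if "e \<in> J" for e
  proof -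
    have "e \<notin> line"
    proof
      assume "e \<in> line"
      then obtain h where "(x, h) \<in> e" unfolding line_def by blast
      then show False using x(2) that by force
    qed
    then show ?thesis using J(1) that by (auto simp: \<omega>1_def \<omega>0_def)
  qed
  moreover have "\<omega>1 \<in> ladder_edges V E \<rightarrow>\<^sub>E UNIV" "\<omega>0 \<in> ladder_edges V E \<rightarrow>\<^sub>E UNIV"
    by (auto simp: \<omega>1_def \<omega>0_def)
  ultimately have iff: "\<omega>1 \<in> infinite_cluster_event V E \<longleftrightarrow> \<omega>0 \<in> infinite_cluster_event V E"
    using dep by blast
  have "\<omega>0 \<notin> infinite_cluster_event V E"
  proof -
    have O: "{e \<in> ladder_edges V E. \<omega>0 e} = {}" by (auto simp: \<omega>0_def)
    have "{y. (a, y) \<in> reach {}} = {a}" for a :: "'a \<times> int"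
      using reach_endpoint[of a _ "{}"] by auto
    then have "finite {y. (a, y) \<in> reach {e \<in> ladder_edges V E. \<omega>0 e}}" for a
      unfolding O by simp
    then show ?thesis unfolding infinite_cluster_event_eq[OF assms(1)] by blast
  qed
  moreover have "\<omega>1 \<in> infinite_cluster_event V E"
  proof -
    let ?O = "{e \<in> ladder_edges V E. \<omega>1 e}"
    have "((x, 0), (x, int n)) \<in> reach ?O" for n
    proof (induction n)
      case (Suc n)
      have "{(x, int n), (x, int n + 1)} \<in> ?O"
        using x(1) by (auto simp: \<omega>1_def line_def vertical_in_ladder_edges)
      then have "{(x, int n), (x, int (Suc n))} \<in> ?O" by (simp add: add.commute)
      with Suc show ?case by (rule reach_step)
    qed simp
    then have "range (\<lambda>n. (x, int n)) \<subseteq> {y. ((x, 0), y) \<in> reach ?O}" by auto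
    moreover have "infinite (range (\<lambda>n. (x, int n)))"
      by (intro range_inj_infinite) (auto simp: inj_on_def)
    ultimately have "infinite {y. ((x, 0), y) \<in> reach ?O}" using finite_subset by blast
    moreover have "(x, 0) \<in> ladder_verts V" using x(1) by (simp add: ladder_verts_def)
    ultimately show ?thesis using \<open>\<omega>1 \<in> ladder_edges V E \<rightarrow>\<^sub>E UNIV\<close>
      unfolding infinite_cluster_event_eq[OF assms(1)] by blast
  qed
  ultimately show False using iff by simp
qed

lemma AE_bern_product_closed:
  assumes "e \<in> I" "\<rho> e = 0"
  shows "AE \<omega> in bern_product \<rho> I. \<not> \<omega> e"
  unfolding bern_product_def
proof (rule AE_PiM_component[where P = "\<lambda>b. \<not> b"])
  have "pmf (bernoulli_pmf (\<rho> e)) True = 0" using assms(2) by simp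
  then show "AE b in measure_pmf (bernoulli_pmf (\<rho> e)). \<not> b"
    unfolding AE_measure_pmf_iff by (metis (full_types) set_pmf_iff)
qed (simp_all add: assms(1) prob_space_measure_pmf)

text \<open>No percolation on a ladder over a finite set \<open>X\<close>: infinitely many horizontal cuts, both above
  and below, consist of closed edges.\<close>
lemma no_percolation_finite_base:
  assumes sg: "simple_graph V E" and cV: "countable V"
    and X: "finite X" "X \<subseteq> V"
    and \<rho>: "\<And>e. e \<in> ladder_edges V E \<Longrightarrow> 0 \<le> \<rho> e \<and> \<rho> e \<le> 1"
    and out: "\<And>e. e \<in> ladder_edges V E \<Longrightarrow> \<not> e \<subseteq> X \<times> UNIV \<Longrightarrow> \<rho> e = 0"
    and c: "0 < c" "c \<le> 1" and vert: "\<And>x h. x \<in> X \<Longrightarrow> \<rho> {(x, h), (x, h + 1)} \<le> 1 - c"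
  shows "measure (bern_product \<rho> (ladder_edges V E)) (infinite_cluster_event V E) = 0"
proof -
  interpret prob_space "bern_product \<rho> (ladder_edges V E)" by (rule prob_space_bern_product)
  have AE_out: "AE \<omega> in bern_product \<rho> (ladder_edges V E).
      \<forall>e\<in>{e \<in> ladder_edges V E. \<not> e \<subseteq> X \<times> UNIV}. \<not> \<omega> e"
  proof (rule AE_ball_countable')
    show "AE \<omega> in bern_product \<rho> (ladder_edges V E). \<not> \<omega> e"
      if "e \<in> {e \<in> ladder_edges V E. \<not> e \<subseteq> X \<times> UNIV}" for e
      using that out by (intro AE_bern_product_closed) auto
    show "countable {e \<in> ladder_edges V E. \<not> e \<subseteq> X \<times> UNIV}"
      using countable_ladder_edges[OF sg cV] by (rule countable_subset[rotated]) auto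
  qed
  have cut: "AE \<omega> in bern_product \<rho> (ladder_edges V E).
      \<forall>m. \<exists>n\<ge>m. \<forall>e\<in>(\<lambda>x. {(x, f n), (x, f n + 1)}) ` X. \<omega> e = False"
    if "inj f" for f :: "nat \<Rightarrow> int"
  proof (rule bern_product_infinitely_often[where c = "c ^ card X"])
    let ?F = "\<lambda>n. (\<lambda>x. {(x, f n), (x, f n + 1)}) ` X"
    show "finite (?F n)" for n using X by simp
    show F: "?F n \<subseteq> ladder_edges V E" for n
      using X(2) by (intro image_subsetI vertical_in_ladder_edges) auto
    have level: "Min (snd ` e) = f n" if "e \<in> ?F n" for e n using that by auto
    show "disjoint_family ?F"
      unfolding disjoint_family_on_def
    proof (intro ballI impI)
      fix n m :: nat assume "n \<noteq> m"
      then have "f n \<noteq> f m" using that by (auto dest: injD)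
      show "?F n \<inter> ?F m = {}"
      proof (intro equals0I)
        fix e assume "e \<in> ?F n \<inter> ?F m"
        then have "f n = f m" using level[of e n] level[of e m] by simp
        with \<open>f n \<noteq> f m\<close> show False ..
      qed
    qed
    show "c ^ card X \<le> (\<Prod>e\<in>?F n. if False then \<rho> e else 1 - \<rho> e)" for n
    proof -
      have "c ^ card X \<le> c ^ card (?F n)"
        using X c by (intro power_decreasing card_image_le) auto
      also have "\<dots> = (\<Prod>e\<in>?F n. c)" by simp
      also have "\<dots> \<le> (\<Prod>e\<in>?F n. 1 - \<rho> e)"
      proof (rule prod_mono)
        fix e assume "e \<in> ?F n"
        then obtain x where "x \<in> X" "e = {(x, f n), (x, f n + 1)}" by (rule imageE)
        then show "0 \<le> c \<and> c \<le> 1 - \<rho> e" using vert[of x "f n"] c by simp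
      qed
      finally show ?thesis by simp
    qed
  qed (use \<rho> c in auto)
  have inj_down: "inj (\<lambda>n. - int n - 1)" by (auto simp: inj_on_def)
  have AE_fin: "AE \<omega> in bern_product \<rho> (ladder_edges V E). \<omega> \<notin> infinite_cluster_event V E"
    using AE_out cut[OF inj_of_nat] cut[OF inj_down]
  proof (eventually_elim)
    case (elim \<omega>)
    let ?O = "{e \<in> ladder_edges V E. \<omega> e}"
    have "finite {y. (x, y) \<in> reach ?O}" for x
    proof -
      obtain a h0 where x: "x = (a, h0)" by force
      obtain n where n: "n \<ge> nat \<bar>h0\<bar>" "\<And>b. b \<in> X \<Longrightarrow> \<not> \<omega> {(b, int n), (b, int n + 1)}"
        using elim(2) by (metis (no_types, lifting) imageI)
      obtain m where m: "m \<ge> nat \<bar>h0\<bar>" "\<And>b. b \<in> X \<Longrightarrow> \<not> \<omega> {(b, - int m - 1), (b, - int m - 1 + 1)}"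
        using elim(3) by (metis (no_types, lifting) imageI)
      have "y = x \<or> y \<in> X \<times> {- int m..int n}" if "(x, y) \<in> reach ?O" for y
        using that
      proof (induction rule: reach_induct)
        case (step y z)
        then have e: "{y, z} \<in> ladder_edges V E" "\<omega> {y, z}" by auto
        then have sub: "{y, z} \<subseteq> X \<times> UNIV" using elim(1) by auto
        have hy: "- int m \<le> snd y" "snd y \<le> int n" using step.IH n(1) m(1) x by auto
        have "- int m \<le> snd z \<and> snd z \<le> int n"
          using sg e(1)
        proof (cases rule: ladder_edge_cases)
          case (rung a b h)
          then show ?thesis using hy by (auto simp: doubleton_eq_iff)
        next
          case (vertical b h)
          then have bX: "b \<in> X" using sub by auto
          have "h \<noteq> int n" "h \<noteq> - int m - 1" using n(2)[OF bX] m(2)[OF bX] e(2) vertical by auto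
          then show ?thesis using vertical hy by (auto simp: doubleton_eq_iff)
        qed
        then show ?case using sub by (cases z) auto
      qed simp
      then have "{y. (x, y) \<in> reach ?O} \<subseteq> insert x (X \<times> {- int m..int n})" by auto
      then show ?thesis by (rule finite_subset) (use X(1) in auto)
    qed
    then show ?case by (auto simp: infinite_cluster_event_eq[OF sg])
  qed
  show ?thesis
  proof (cases "infinite_cluster_event V E \<in> events")
    case True
    then show ?thesis
      using AE_fin by (subst prob_eq_0) auto
  qed (simp add: measure_notin_sets)
qed

text \<open>At a vertex of infinite degree infinitely many edges are open, whatever the positive
  parameters.\<close>
lemma percolation_infinite_degree:
  assumes sg: "simple_graph V E" and a: "infinite {b. {a, b} \<in> E}"
    and \<rho>: "\<And>e. e \<in> ladder_edges V E \<Longrightarrow> 0 \<le> \<rho> e \<and> \<rho> e \<le> 1"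
    and c: "0 < c" "\<And>e. e \<in> ladder_edges V E \<Longrightarrow> c \<le> \<rho> e"
    and ev: "infinite_cluster_event V E \<in> sets (bern_product \<rho> (ladder_edges V E))"
  shows "measure (bern_product \<rho> (ladder_edges V E)) (infinite_cluster_event V E) = 1"
proof -
  interpret prob_space "bern_product \<rho> (ladder_edges V E)" by (rule prob_space_bern_product)
  obtain f :: "nat \<Rightarrow> 'a" where f: "inj f" "\<And>n. {a, f n} \<in> E"
    using infinite_countable_subset[OF a] by auto
  define F where "F n = {{(a, 0 :: int), (f n, 0)}}" for n
  have "AE \<omega> in bern_product \<rho> (ladder_edges V E). \<forall>m. \<exists>n\<ge>m. \<forall>e\<in>F n. \<omega> e = True"
  proof (rule bern_product_infinitely_often[where c = c])
    show FL: "F n \<subseteq> ladder_edges V E" for n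
      using f(2) by (simp add: F_def rung_in_ladder_edges)
    show "disjoint_family F"
      using f(1) by (auto simp: disjoint_family_on_def F_def doubleton_eq_iff dest: injD)
    show "c \<le> (\<Prod>e\<in>F n. if True then \<rho> e else 1 - \<rho> e)" for n
      using c(2) FL[of n] by (simp add: F_def)
  qed (use \<rho> c F_def in auto)
  then have "AE \<omega> in bern_product \<rho> (ladder_edges V E). \<omega> \<in> infinite_cluster_event V E"
    using AE_space
  proof (eventually_elim)
    case (elim \<omega>)
    let ?O = "{e \<in> ladder_edges V E. \<omega> e}"
    define A where "A = {n. \<omega> {(a, 0 :: int), (f n, 0)}}"
    have "infinite A" using elim(1) by (auto simp: A_def F_def infinite_nat_iff_unbounded_le)
    then have "infinite ((\<lambda>n. (f n, 0 :: int)) ` A)"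
      by (subst finite_image_iff) (use f(1) in \<open>auto simp: inj_on_def\<close>)
    moreover have "(\<lambda>n. (f n, 0 :: int)) ` A \<subseteq> {y. ((a, 0), y) \<in> reach ?O}"
      using f(2) by (auto simp: A_def intro!: reach_edge rung_in_ladder_edges)
    ultimately have "infinite {y. ((a, 0), y) \<in> reach ?O}" using finite_subset by blast
    moreover have "(a, 0) \<in> ladder_verts V"
      using ladder_edge_subset[OF sg rung_in_ladder_edges[OF f(2)[of 0], of 0]] by auto
    ultimately show ?case using elim(2) by (auto simp: infinite_cluster_event_eq[OF sg])
  qed
  then show ?thesis using ev by (subst prob_eq_1) auto
qed

section \<open>Blocks around the columns\<close>

text \<open>A finite connected part of the base graph can be listed so that every vertex but the first has
  a neighbour earlier in the list.\<close>
lemma exists_growth_list: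
  assumes "connected_graph V E" "finite X" "X \<subseteq> V" "r \<in> V"
  shows "\<exists>xs. xs \<noteq> [] \<and> xs ! 0 = r \<and> distinct xs \<and> set xs \<subseteq> V \<and> X \<subseteq> set xs \<and>
    (\<forall>i<length xs. 0 < i \<longrightarrow> (\<exists>j<i. {xs ! i, xs ! j} \<in> E))"
proof -
  define good where "good xs \<longleftrightarrow> xs \<noteq> [] \<and> xs ! 0 = r \<and> distinct xs \<and> set xs \<subseteq> V \<and>
    (\<forall>i<length xs. 0 < i \<longrightarrow> (\<exists>j<i. {xs ! i, xs ! j} \<in> E))" for xs
  have sub: "\<Union>E \<subseteq> V" using assms(1) by (auto simp: connected_graph_def simple_graph_def)
  have extend: "\<exists>ys. good ys \<and> set xs \<subseteq> set ys \<and> y \<in> set ys" if xs: "good xs" and y: "(r, y) \<in> reach E" for xs y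
    using y
  proof (induction rule: reach_induct)
    case refl
    then show ?case using xs by (intro exI[of _ xs]) (auto simp: good_def in_set_conv_nth)
  next
    case (step y z)
    then obtain ys where ys: "good ys" "set xs \<subseteq> set ys" "y \<in> set ys" by auto
    show ?case
    proof (cases "z \<in> set ys")
      case True
      then show ?thesis using ys by auto
    next
      case False
      obtain j where j: "j < length ys" "ys ! j = y" using ys(3) by (auto simp: in_set_conv_nth)
      have "\<exists>j<i. {(ys @ [z]) ! i, (ys @ [z]) ! j} \<in> E" if i: "i < length (ys @ [z])" "0 < i" for i
      proof (cases "i < length ys")
        case True
        then obtain k where "k < i" "{ys ! i, ys ! k} \<in> E" using ys(1) i(2) by (auto simp: good_def)
        then show ?thesis using True by (intro exI[of _ k]) (auto simp: nth_append)
      next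
        case False
        then have "i = length ys" using i by simp
        then show ?thesis using j step.hyps(2)
          by (intro exI[of _ j]) (auto simp: nth_append insert_commute)
      qed
      moreover have "z \<in> V" using sub step.hyps(2) by auto
      ultimately have "good (ys @ [z])"
        using ys(1) False by (auto simp: good_def nth_append)
      then show ?thesis using ys by (intro exI[of _ "ys @ [z]"]) auto
    qed
  qed
  have "\<exists>xs. good xs \<and> X \<subseteq> set xs"
    using assms(2,3)
  proof (induction X rule: finite_induct)
    case empty
    then show ?case using assms(4) by (intro exI[of _ "[r]"]) (auto simp: good_def)
  next
    case (insert x X)
    then obtain xs where "good xs" "X \<subseteq> set xs" by auto
    then show ?case
      using extend[of xs x] connected_graph_reach[OF assms(1,4), of x] insert.prems by auto
  qed
  then show ?thesis unfolding good_def by blast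
qed

text \<open>The vertices \<open>xs\<close> span a connected finite part of a locally finite base graph. \<open>Col\<close> is a set of
  ladder edges over this part, the column edges in the application. The line over the first vertex
  avoids \<open>Col\<close>, and so does the line over each vertex of the part that has a neighbour outside.\<close>
locale ladder_blocks =
  fixes V :: "'v set" and E :: "'v set set" and Col :: "('v \<times> int) set set" and xs :: "'v list"
  assumes sg: "simple_graph V E"
    and locally_finite: "\<And>a. finite {b. {a, b} \<in> E}"
    and xs: "xs \<noteq> []" "distinct xs" "set xs \<subseteq> V"
    and tree: "\<And>i. 0 < i \<Longrightarrow> i < length xs \<Longrightarrow> \<exists>j<i. {xs ! i, xs ! j} \<in> E"
    and col_base: "\<And>e. e \<in> Col \<Longrightarrow> fst ` e \<subseteq> set xs"
    and root_free: "\<And>h. {(xs ! 0, h), (xs ! 0, h + 1)} \<notin> Col"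
    and rim_free: "\<And>y z h. {y, z} \<in> E \<Longrightarrow> y \<notin> set xs \<Longrightarrow> z \<in> set xs \<Longrightarrow> {(z, h), (z, h + 1)} \<notin> Col"
begin

abbreviation "edges \<equiv> ladder_edges V E"

text \<open>Block \<open>n\<close> consists of the edges that meet a line over \<open>xs\<close> and whose lower end has a height in
  \<open>[n * height, (n + 1) * height)\<close>. Its height exceeds twice every index into \<open>xs\<close>, so that two
  families of hooks fit on top of each other.\<close>
definition height :: int where "height = 2 * int (length xs)"

text \<open>The block of an edge. Every edge that meets no line over \<open>xs\<close> is a block of its own.\<close>
definition key :: "('v \<times> int) set \<Rightarrow> int + ('v \<times> int) set" where
  "key e = (if fst ` e \<inter> set xs \<noteq> {} then Inl (Min (snd ` e) div height) else Inr e)"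

text \<open>Interior vertices: all their edges belong to the block.\<close>
definition inner :: "int + ('v \<times> int) set \<Rightarrow> ('v \<times> int) set" where
  "inner k = (case k of
     Inl n \<Rightarrow> {(a, h). a \<in> set xs \<and> n * height < h \<and> h < (n + 1) * height} | Inr _ \<Rightarrow> {})"

text \<open>The vertices of the ladder that are interior to no block.\<close>
definition outer :: "('v \<times> int) set" where
  "outer = {(a, h). a \<in> V \<and> (a \<in> set xs \<longrightarrow> height dvd h)}"

definition block :: "int \<Rightarrow> ('v \<times> int) set set" where
  "block n = {e \<in> edges. key e = Inl n}"

lemma height_pos: "0 < height"
  using xs(1) by (simp add: height_def)

lemma div_height_iff: "h div height = n \<longleftrightarrow> n * height \<le> h \<and> h < (n + 1) * height"
proof
  assume "h div height = n"
  then have "n * height + h mod height = h" using div_mult_mod_eq[of h height] by simp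
  moreover have "0 \<le> h mod height" "h mod height < height" using height_pos by auto
  ultimately show "n * height \<le> h \<and> h < (n + 1) * height"
    unfolding distrib_right by linarith
next
  assume *: "n * height \<le> h \<and> h < (n + 1) * height"
  have "(n * height + (h - n * height)) div height = n"
    using * height_pos by (subst div_mult_self3) (auto simp: algebra_simps)
  then show "h div height = n" by simp
qed

lemma key_rung:
  "key {(a, h), (b, h)} = Inl n \<longleftrightarrow> (a \<in> set xs \<or> b \<in> set xs) \<and> h div height = n"
  by (auto simp: key_def)

lemma key_vertical:
  "key {(a, h), (a, h + 1)} = Inl n \<longleftrightarrow> a \<in> set xs \<and> h div height = n"
  by (auto simp: key_def)

lemma key_of_inner:
  assumes "e \<in> edges" "e \<inter> inner k \<noteq> {}"
  shows "key e = k"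
proof -
  obtain n where k: "k = Inl n" using assms(2) by (cases k) (auto simp: inner_def)
  from sg assms(1) show ?thesis
  proof (cases rule: ladder_edge_cases)
    case (rung a b h)
    then show ?thesis unfolding k using assms(2)
      by (auto simp: k inner_def key_rung div_height_iff)
  next
    case (vertical a h)
    then show ?thesis unfolding k using assms(2)
      by (auto simp: k inner_def key_vertical div_height_iff)
  qed
qed

lemma outer_inner_disjoint: "outer \<inter> inner k = {}"
proof (cases k)
  case (Inl n)
  have False if "n * height < h" "h < (n + 1) * height" "height dvd h" for h
  proof -
    obtain j where "h = height * j" using \<open>height dvd h\<close> by auto
    then have "n < j" "j < n + 1" using that(1,2) height_pos by (auto simp: mult.commute)
    then show False by simp
  qed
  then show ?thesis by (auto simp: Inl outer_def inner_def)
qed (auto simp: inner_def)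

lemma in_inner_if_not_outer:
  assumes "(a, h) \<in> ladder_verts V" "(a, h) \<notin> outer"
  shows "(a, h) \<in> inner (Inl (h div height))"
proof -
  have a: "a \<in> set xs" "\<not> height dvd h" using assms by (auto simp: outer_def ladder_verts_def)
  have "h div height * height \<le> h \<and> h < (h div height + 1) * height"
    using div_height_iff[of h "h div height"] by simp
  moreover have "h div height * height \<noteq> h" using a(2) by (metis dvd_triv_right)
  ultimately show ?thesis using a(1) by (auto simp: inner_def)
qed

lemma finite_incident: "finite {e \<in> E. e \<inter> set xs \<noteq> {}}"
proof (rule finite_subset)
  show "{e \<in> E. e \<inter> set xs \<noteq> {}} \<subseteq> (\<Union>a\<in>set xs. (\<lambda>b. {a, b}) ` {b. {a, b} \<in> E})"
  proof
    fix e assume e: "e \<in> {e \<in> E. e \<inter> set xs \<noteq> {}}"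
    then obtain a b where ab: "e = {a, b}" using sg unfolding simple_graph_def by blast
    then consider "a \<in> set xs" | "b \<in> set xs" using e by auto
    then show "e \<in> (\<Union>a\<in>set xs. (\<lambda>b. {a, b}) ` {b. {a, b} \<in> E})"
    proof cases
      case 2
      have "{b, a} = e" using ab by auto
      then show ?thesis using 2 e by blast
    qed (use e ab in auto)
  qed
qed (use locally_finite in auto)

text \<open>All blocks are translates of each other; only a common bound on their size matters.\<close>
lemma block_size: "\<exists>N. \<forall>n. finite (block n) \<and> card (block n) \<le> N"
proof (intro exI allI)
  fix n
  let ?A = "{e \<in> E. e \<inter> set xs \<noteq> {}} \<times> {0..<height}" and ?B = "set xs \<times> {0..<height}"
  let ?f = "\<lambda>(e :: 'v set, k). e \<times> {n * height + k}"
  let ?g = "\<lambda>(a :: 'v, k). {(a, n * height + k), (a, n * height + k + 1)}"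
  have "block n \<subseteq> ?f ` ?A \<union> ?g ` ?B"
  proof
    fix e assume "e \<in> block n"
    then have e: "e \<in> edges" "key e = Inl n" by (auto simp: block_def)
    from sg e(1) show "e \<in> ?f ` ?A \<union> ?g ` ?B"
    proof (cases rule: ladder_edge_cases)
      case (rung a b h)
      then have *: "a \<in> set xs \<or> b \<in> set xs" "n * height \<le> h" "h < (n + 1) * height"
        using e(2) key_rung div_height_iff by auto
      then have "({a, b}, h - n * height) \<in> ?A" using rung by (auto simp: algebra_simps)
      moreover have "e = ?f ({a, b}, h - n * height)" using rung by auto
      ultimately show ?thesis by blast
    next
      case (vertical a h)
      then have *: "a \<in> set xs" "n * height \<le> h" "h < (n + 1) * height"
        using e(2) key_vertical div_height_iff by auto
      then have "(a, h - n * height) \<in> ?B" by (auto simp: algebra_simps)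
      moreover have "e = ?g (a, h - n * height)" using vertical by auto
      ultimately show ?thesis by blast
    qed
  qed
  moreover have fin: "finite ?A" "finite ?B" using finite_incident by auto
  ultimately have "finite (block n)" "card (block n) \<le> card (?f ` ?A \<union> ?g ` ?B)"
    by (auto intro: finite_subset card_mono)
  moreover have "card (?f ` ?A \<union> ?g ` ?B) \<le> card ?A + card ?B"
    using card_Un_le[of "?f ` ?A" "?g ` ?B"] card_image_le[OF fin(1), of ?f] card_image_le[OF fin(2), of ?g]
    by linarith
  ultimately show "finite (block n) \<and> card (block n) \<le> card ?A + card ?B" by simp
qed

text \<open>A path passes from the interior of one block to that of another through vertices of \<open>outer\<close>
  only. A cluster with finitely many vertices in \<open>outer\<close> thus meets finitely many interiors.\<close>
lemma infinite_outer_cluster: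
  assumes S: "S \<subseteq> edges" and x: "x \<in> ladder_verts V" and inf: "infinite {y. (x, y) \<in> reach S}"
  shows "\<exists>a\<in>outer. infinite {y \<in> outer. (a, y) \<in> reach S}"
proof -
  define C where "C = {y. (x, y) \<in> reach S}"
  have CV: "C \<subseteq> ladder_verts V"
  proof
    fix y assume "y \<in> C"
    then show "y \<in> ladder_verts V"
      using reach_endpoint[of x y S] x S ladder_edge_subset[OF sg] by (auto simp: C_def)
  qed
  have "infinite (C \<inter> outer)"
  proof
    assume fin: "finite (C \<inter> outer)"
    \<comment> \<open>The blocks that contain \<open>x\<close> or touch one of the finitely many vertices in \<open>C \<inter> outer\<close>.\<close>
    define K where "K = insert (snd x div height)
      (\<Union>b\<in>C \<inter> outer. {snd b div height, snd b div height - 1})"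
    have step_in: "y \<in> outer \<or> y \<in> (\<Union>n\<in>K. inner (Inl n))" if "(x, y) \<in> reach S" for y
      using that
    proof (induction rule: reach_induct)
      case refl
      then show ?case using in_inner_if_not_outer[of "fst x" "snd x"] x by (auto simp: K_def)
    next
      case (step y z)
      have e: "{y, z} \<in> edges" using step(2) S by auto
      have yC: "y \<in> C" and zC: "z \<in> C" using step(1,2) reach_step by (auto simp: C_def)
      show ?case
      proof (cases "z \<in> outer")
        case False
        define n where "n = snd z div height"
        have zn: "z \<in> inner (Inl n)"
          using in_inner_if_not_outer[of "fst z" "snd z"] zC CV False by (auto simp: n_def)
        have "n \<in> K"
        proof (cases "y \<in> outer")
          case True
          from sg e have hz: "\<bar>snd y - snd z\<bar> \<le> 1"
            by (cases rule: ladder_edge_cases) (auto simp: doubleton_eq_iff)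
          then have "n * height \<le> snd y" "snd y \<le> (n + 1) * height"
            using zn by (auto simp: inner_def)
          then have "snd y div height = n \<or> snd y div height = n + 1"
            using div_height_iff[of "snd y" n] div_height_iff[of "snd y" "n + 1"] height_pos
            by (auto simp: algebra_simps)
          then show ?thesis using True yC by (auto simp: K_def intro!: bexI[of _ y])
        next
          case False
          then obtain k where k: "k \<in> K" "y \<in> inner (Inl k)" using step.IH by auto
          have "key {y, z} = Inl k" "key {y, z} = Inl n"
            using k zn by (auto intro!: key_of_inner[OF e])
          then show ?thesis using k by simp
        qed
        then show ?thesis using zn by auto
      qed simp
    qed
    have "C \<subseteq> (C \<inter> outer) \<union> (\<Union>n\<in>K. inner (Inl n))"
      using step_in by (auto simp: C_def)
    moreover have "finite (inner (Inl n))" for n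
    proof (rule finite_subset)
      show "inner (Inl n) \<subseteq> set xs \<times> {n * height..(n + 1) * height}" by (auto simp: inner_def)
    qed simp
    moreover have "finite K" using fin by (simp add: K_def)
    ultimately have "finite C" using fin by (meson finite_UN finite_UnI finite_subset)
    then show False using inf by (simp add: C_def)
  qed
  then obtain a where a: "a \<in> C" "a \<in> outer" by (metis IntE finite.emptyI ex_in_conv)
  have "C \<inter> outer \<subseteq> {y \<in> outer. (a, y) \<in> reach S}"
    using a(1) reach_sym reach_trans by (fastforce simp: C_def)
  then show ?thesis using \<open>infinite (C \<inter> outer)\<close> a(2) finite_subset by blast
qed

text \<open>The position of a vertex in the list \<open>xs\<close>.\<close>
definition index :: "'v \<Rightarrow> nat" where
  "index = the_inv_into {..<length xs} ((!) xs)"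

lemma index_nth: "j < length xs \<Longrightarrow> index (xs ! j) = j"
  unfolding index_def using xs(2) by (intro the_inv_into_f_f) (auto simp: inj_on_nth)

lemma index_inj: "a \<in> set xs \<Longrightarrow> b \<in> set xs \<Longrightarrow> index a = index b \<Longrightarrow> a = b"
  by (metis in_set_conv_nth index_nth)

text \<open>The level sets of this label are hooks: the hook of label \<open>i\<close> in the lower half of block \<open>n\<close>
  goes straight up from the \<open>i\<close>-th vertex in the bottom layer to relative height \<open>i\<close>, where
  it spreads over the vertices of smaller index and so reaches the line over the first vertex. The
  upper half is the mirror image, with one additional row in the middle. Different hooks are
  disjoint.\<close>
definition hook :: "int \<Rightarrow> 'v \<times> int \<Rightarrow> bool \<times> int" where
  "hook n = (\<lambda>(a, h). let k = h - n * height in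
     if k < int (length xs) then (False, max (int (index a)) k)
     else (True, max (int (index a)) (height - k)))"

text \<open>The column edges of the block that join vertices of the same hook.\<close>
definition pattern :: "int \<Rightarrow> ('v \<times> int) set set" where
  "pattern n = {e \<in> block n \<inter> Col. \<forall>x\<in>e. \<forall>y\<in>e. hook n x = hook n y}"

lemma block_heights:
  assumes "e \<in> block n" "(a, h) \<in> e"
  shows "n * height \<le> h \<and> h \<le> (n + 1) * height"
proof -
  have e: "e \<in> edges" "key e = Inl n" using assms(1) by (auto simp: block_def)
  from sg e(1) show ?thesis
  proof (cases rule: ladder_edge_cases)
    case (rung a b h)
    then have "n * height \<le> h" "h < (n + 1) * height"
      using e(2) key_rung div_height_iff by auto
    then show ?thesis using rung assms(2) by auto
  next
    case (vertical a h)
    then have "n * height \<le> h" "h < (n + 1) * height"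
      using e(2) key_vertical div_height_iff by auto
    then show ?thesis using vertical assms(2) by auto
  qed
qed

lemma boundary_height:
  assumes "a \<in> set xs" "n * height \<le> h" "h \<le> (n + 1) * height" "(a, h) \<notin> inner (Inl n)"
  shows "h = n * height \<or> h = (n + 1) * height"
  using assms by (auto simp: inner_def)

text \<open>On its own, the pattern connects no two vertices outside the interior: a hook contains only
  one of them.\<close>
lemma pattern_isolates: "connects_less (inner (Inl n)) (pattern n) {}"
  unfolding connects_less_def
proof (intro allI impI)
  fix c y assume c: "c \<notin> inner (Inl n)" and y: "y \<notin> inner (Inl n)" and r: "(c, y) \<in> reach (pattern n)"
  define good where "good z \<longleftrightarrow> fst z \<in> set xs \<and> n * height \<le> snd z \<and> snd z \<le> (n + 1) * height" for z :: "'v \<times> int"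
  have "c = y \<or> good c \<and> good y \<and> hook n c = hook n y"
    using r
  proof (induction rule: reach_induct)
    case (step y z)
    have e: "{y, z} \<in> block n" "{y, z} \<in> Col" "hook n y = hook n z"
      using step(2) unfolding pattern_def by blast+
    have "good y" "good z"
      using col_base[OF e(2)] block_heights[OF e(1), of "fst y" "snd y"]
        block_heights[OF e(1), of "fst z" "snd z"] by (auto simp: good_def)
    then show ?case using step.IH e(3) by auto
  qed simp
  moreover have "c = y" if g: "good c" "good y" and h: "hook n c = hook n y"
  proof -
    have hc: "snd c = n * height \<or> snd c = (n + 1) * height"
      using boundary_height[of "fst c" n "snd c"] g c by (auto simp: good_def)
    have hy: "snd y = n * height \<or> snd y = (n + 1) * height"
      using boundary_height[of "fst y" n "snd y"] g y by (auto simp: good_def)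
    have m: "0 < int (length xs)" "height = 2 * int (length xs)" using xs(1) by (auto simp: height_def)
    have bottom: "hook n (a, n * height) = (False, int (index a))" for a
      using m by (simp add: hook_def)
    have top: "hook n (a, (n + 1) * height) = (True, int (index a))" for a
      using m by (simp add: hook_def Let_def algebra_simps)
    have "snd c = snd y \<and> index (fst c) = index (fst y)"
      using hc hy h bottom[of "fst c"] bottom[of "fst y"] top[of "fst c"] top[of "fst y"]
      by (cases c; cases y) auto
    then show ?thesis using g index_inj[of "fst c" "fst y"] by (auto simp: good_def prod_eq_iff)
  qed
  ultimately show "(c, y) \<in> reach {}" by auto
qed

text \<open>The pattern together with all edges of the block outside the columns.\<close>
abbreviation "completed n \<equiv> pattern n \<union> (block n - Col)"

lemma in_completed:
  assumes "e \<in> block n" "\<And>x y. x \<in> e \<Longrightarrow> y \<in> e \<Longrightarrow> hook n x = hook n y"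
  shows "e \<in> completed n"
  using assms unfolding pattern_def by blast

lemma vertical_in_block:
  assumes "a \<in> set xs" "h div height = n"
  shows "{(a, h), (a, h + 1)} \<in> block n"
  using assms xs(3) by (auto simp: block_def key_vertical vertical_in_ladder_edges)

lemma rung_in_block:
  assumes "{a, b} \<in> E" "b \<in> set xs" "h div height = n"
  shows "{(a, h), (b, h)} \<in> block n"
  using assms by (auto simp: block_def key_rung rung_in_ladder_edges)

lemma free_line_connected:
  assumes a: "a \<in> set xs" "\<And>h. {(a, h), (a, h + 1)} \<notin> Col"
    and h: "n * height \<le> h" "h \<le> (n + 1) * height"
  shows "((a, h), (a, n * height)) \<in> reach (completed n)"
proof -
  have "((a, n * height), (a, n * height + int k)) \<in> reach (completed n)" if "int k \<le> height" for k
    using that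
  proof (induction k)
    case (Suc k)
    have "(n * height + int k) div height = n"
      using Suc.prems by (simp add: div_height_iff algebra_simps)
    from vertical_in_block[OF a(1) this]
    have e: "{(a, n * height + int k), (a, n * height + int k + 1)} \<in> completed n"
      using a(2)[of "n * height + int k"] by simp
    have "int k \<le> height" using Suc.prems by simp
    from reach_step[OF Suc.IH[OF this] e]
    have "((a, n * height), (a, n * height + int k + 1)) \<in> reach (completed n)" .
    then show ?case by (simp add: algebra_simps)
  qed simp
  from this[of "nat (h - n * height)"] h
  have "((a, n * height), (a, h)) \<in> reach (completed n)" by (simp add: algebra_simps)
  then show ?thesis by (rule reach_sym)
qed

text \<open>A hook is connected in the completed pattern. Both halves of a block are covered by letting \<open>ht\<close> run upwards from the bottom or downwards
  from the top.\<close>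
lemma hook_connected:
  assumes i: "i < length xs"
    and lab: "\<And>j k. j \<le> i \<Longrightarrow> k \<le> i \<Longrightarrow> hook n (xs ! j, ht k) = (b, max (int j) (int k))"
    and up: "\<And>k. k < i \<Longrightarrow> \<exists>h. {ht k, ht (Suc k)} = {h, h + 1} \<and> h div height = n"
    and top: "0 < i \<Longrightarrow> ht i div height = n"
  shows "((xs ! i, ht 0), (xs ! 0, ht i)) \<in> reach (completed n)"
proof -
  have vert: "((xs ! i, ht 0), (xs ! i, ht k)) \<in> reach (completed n)" if "k \<le> i" for k
    using that
  proof (induction k)
    case (Suc k)
    obtain h where h: "{ht k, ht (Suc k)} = {h, h + 1}" "h div height = n"
      using up[of k] Suc.prems by auto
    have "{(xs ! i, ht k), (xs ! i, ht (Suc k))} = {(xs ! i, h), (xs ! i, h + 1)}"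
      using h(1) by (auto simp: doubleton_eq_iff)
    then have "{(xs ! i, ht k), (xs ! i, ht (Suc k))} \<in> block n"
      using vertical_in_block[of "xs ! i" h n] h(2) i by simp
    then have "{(xs ! i, ht k), (xs ! i, ht (Suc k))} \<in> completed n"
      by (rule in_completed) (use lab[of i k] lab[of i "Suc k"] Suc.prems in auto)
    with Suc show ?case by (auto intro: reach_step)
  qed simp
  have hor: "((xs ! j, ht i), (xs ! 0, ht i)) \<in> reach (completed n)" if "j \<le> i" for j
    using that
  proof (induction j rule: less_induct)
    case (less j)
    show ?case
    proof (cases "j = 0")
      case False
      then obtain l where l: "l < j" "{xs ! j, xs ! l} \<in> E" using tree[of j] less.prems i by auto
      have "{(xs ! j, ht i), (xs ! l, ht i)} \<in> block n"
        using rung_in_block[OF l(2)] l(1) less.prems i top by auto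
      then have "{(xs ! j, ht i), (xs ! l, ht i)} \<in> completed n"
        by (rule in_completed) (use lab[of j i] lab[of l i] l(1) less.prems in auto)
      then have "((xs ! j, ht i), (xs ! l, ht i)) \<in> reach (completed n)" by (rule reach_edge)
      then show ?thesis using less.IH[OF l(1)] l(1) less.prems by (auto intro: reach_trans)
    qed simp
  qed
  show ?thesis using vert[of i] hor[of i] by (auto intro: reach_trans)
qed

lemma boundary_connected:
  assumes "a \<in> set xs" "h = n * height \<or> h = (n + 1) * height"
  shows "((a, h), (xs ! 0, n * height)) \<in> reach (completed n)"
proof -
  obtain i where i: "i < length xs" "a = xs ! i" using assms(1) by (auto simp: in_set_conv_nth)
  have root: "((xs ! 0, h), (xs ! 0, n * height)) \<in> reach (completed n)"
    if "n * height \<le> h" "h \<le> (n + 1) * height" for h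
    using that xs(1) root_free by (intro free_line_connected) auto
  from assms(2) show ?thesis
  proof
    assume h: "h = n * height"
    define ht where "ht k = n * height + int k" for k
    have "((xs ! i, ht 0), (xs ! 0, ht i)) \<in> reach (completed n)"
    proof (rule hook_connected[OF i(1)])
      show "hook n (xs ! j, ht k) = (False, max (int j) (int k))" if "j \<le> i" "k \<le> i" for j k
        using that i(1) by (simp add: hook_def ht_def index_nth)
      show "\<exists>h. {ht k, ht (Suc k)} = {h, h + 1} \<and> h div height = n" if "k < i" for k
      proof (intro exI[of _ "ht k"] conjI)
        show "ht k div height = n" unfolding div_height_iff
          using that i(1) by (simp add: ht_def height_def algebra_simps)
      qed (simp add: ht_def algebra_simps)
      show "ht i div height = n" unfolding div_height_iff
        using i(1) by (simp add: ht_def height_def algebra_simps)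
    qed
    moreover have "((xs ! 0, ht i), (xs ! 0, n * height)) \<in> reach (completed n)"
      using i(1) by (intro root) (auto simp: ht_def height_def algebra_simps)
    ultimately show ?thesis unfolding h i(2) by (auto simp: ht_def intro: reach_trans)
  next
    assume h: "h = (n + 1) * height"
    define ht where "ht k = (n + 1) * height - int k" for k
    have "((xs ! i, ht 0), (xs ! 0, ht i)) \<in> reach (completed n)"
    proof (rule hook_connected[OF i(1)])
      show "hook n (xs ! j, ht k) = (True, max (int j) (int k))" if "j \<le> i" "k \<le> i" for j k
        using that i(1) by (simp add: hook_def ht_def index_nth height_def Let_def algebra_simps)
      show "\<exists>h. {ht k, ht (Suc k)} = {h, h + 1} \<and> h div height = n" if "k < i" for k
      proof (intro exI[of _ "ht (Suc k)"] conjI)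
        show "ht (Suc k) div height = n" unfolding div_height_iff
          using that i(1) by (simp add: ht_def height_def algebra_simps)
      qed (auto simp: ht_def algebra_simps)
      show "ht i div height = n" if "0 < i" unfolding div_height_iff
        using that i(1) by (simp add: ht_def height_def algebra_simps)
    qed
    moreover have "((xs ! 0, ht i), (xs ! 0, n * height)) \<in> reach (completed n)"
      using i(1) by (intro root) (auto simp: ht_def height_def algebra_simps)
    ultimately show ?thesis unfolding h i(2) by (auto simp: ht_def intro: reach_trans)
  qed
qed

text \<open>With the other edges added, every vertex of the block outside its interior is connected to the foot of the
  line over the first vertex: along its hook if it lies over \<open>xs\<close>, and otherwise by way of the line
  over a neighbour in \<open>xs\<close>.\<close>
lemma pattern_connects: "connects_less (inner (Inl n)) (block n) (completed n)"
proof -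
  have root: "(c, (xs ! 0, n * height)) \<in> reach (completed n)"
    if c: "c \<in> \<Union>(block n)" "c \<notin> inner (Inl n)" for c
  proof -
    obtain a h where ah: "c = (a, h)" by force
    obtain e where e: "e \<in> block n" "(a, h) \<in> e" using c(1) ah by auto
    have hh: "n * height \<le> h" "h \<le> (n + 1) * height" using block_heights[OF e] by auto
    show ?thesis
    proof (cases "a \<in> set xs")
      case True
      then show ?thesis using boundary_connected boundary_height[OF True hh] c(2) ah by simp
    next
      case False
      have ek: "e \<in> edges" "key e = Inl n" using e(1) by (auto simp: block_def)
      have "\<exists>b. {a, b} \<in> E \<and> b \<in> set xs \<and> h div height = n"
        using sg ek(1)
      proof (cases rule: ladder_edge_cases)
        case (rung x y k)
        then have *: "x \<in> set xs \<or> y \<in> set xs" "k div height = n" using ek(2) key_rung by auto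
        then consider "x = a" "k = h" "y \<in> set xs" | "y = a" "k = h" "x \<in> set xs"
          using e(2) rung(5) False by auto
        then show ?thesis using rung(1) * by cases (auto simp: insert_commute)
      next
        case (vertical x k)
        then show ?thesis using ek(2) key_vertical e(2) False by auto
      qed
      then obtain b where b: "{a, b} \<in> E" "b \<in> set xs" "h div height = n" by auto
      have "{(a, h), (b, h)} \<in> completed n"
        using rung_in_block[OF b] col_base[of "{(a, h), (b, h)}"] False by auto
      then have 1: "((a, h), (b, h)) \<in> reach (completed n)" by (rule reach_edge)
      have 2: "((b, h), (b, n * height)) \<in> reach (completed n)"
        using b(2) rim_free[OF b(1) False b(2)] hh by (intro free_line_connected)
      have 3: "((b, n * height), (xs ! 0, n * height)) \<in> reach (completed n)"
        using b(2) by (intro boundary_connected) auto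
      show ?thesis unfolding ah by (rule reach_trans[OF 1 reach_trans[OF 2 3]])
    qed
  qed
  show ?thesis
    unfolding connects_less_def
  proof (intro allI impI)
    fix c y assume *: "c \<notin> inner (Inl n)" "y \<notin> inner (Inl n)" "(c, y) \<in> reach (block n)"
    show "(c, y) \<in> reach (completed n)"
    proof (cases "c = y")
      case False
      then have "c \<in> \<Union>(block n)" "y \<in> \<Union>(block n)"
        using reach_endpoint[OF *(3)] reach_endpoint[OF reach_sym[OF *(3)]] by auto
      then show ?thesis using root[of c] root[of y] * reach_sym reach_trans by metis
    qed simp
  qed
qed

text \<open>The constants do not depend on the block, and all edges outside the blocks only gain.\<close>
theorem percolation_comparison:
  assumes cV: "countable V"
    and size: "\<And>n. finite (block n) \<and> card (block n) \<le> N"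
    and d: "0 < d" "d \<le> 1" and \<delta>: "0 < \<delta>" "\<delta> \<le> 1" and \<epsilon>: "0 \<le> \<epsilon>" "real N * \<epsilon> \<le> (\<delta> * d) ^ N"
    and P: "\<And>e. e \<in> edges \<Longrightarrow> e \<notin> Col \<Longrightarrow> 0 \<le> \<rho> e \<and> \<rho> e + d \<le> \<rho>' e \<and> \<rho>' e \<le> 1"
    and Q: "\<And>e. e \<in> edges \<Longrightarrow> e \<in> Col \<Longrightarrow>
      0 \<le> \<rho> e \<and> \<rho> e \<le> 1 \<and> \<delta> \<le> \<rho>' e \<and> \<rho>' e \<le> 1 - \<delta> \<and> \<bar>\<rho> e - \<rho>' e\<bar> \<le> \<epsilon>"
    and pos: "0 < measure (bern_product \<rho> edges) (infinite_cluster_event V E)"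
    and ev: "infinite_cluster_event V E \<in> sets (bern_product \<rho> edges)"
  shows "0 < measure (bern_product \<rho>' edges) (infinite_cluster_event V E)"
proof (rule ccontr)
  interpret P: prob_space "bern_product \<rho> edges" by (rule prob_space_bern_product)
  interpret P': prob_space "bern_product \<rho>' edges" by (rule prob_space_bern_product)
  define Ev where "Ev x = {\<omega> \<in> edges \<rightarrow>\<^sub>E UNIV. infinite {y \<in> outer. (x, y) \<in> reach {e \<in> edges. \<omega> e}}}" for x
  have ev': "infinite_cluster_event V E \<in> P'.events" using ev sets_bern_product_cong by blast
  assume "\<not> 0 < P'.prob (infinite_cluster_event V E)"
  then have null': "P'.prob (infinite_cluster_event V E) = 0"
    by (simp add: zero_less_measure_iff)
  have outerV: "outer \<subseteq> ladder_verts V" by (auto simp: outer_def ladder_verts_def)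
  have EvC: "Ev x \<subseteq> infinite_cluster_event V E" if "x \<in> outer" for x
  proof
    fix \<omega> assume w: "\<omega> \<in> Ev x"
    have "{y \<in> outer. (x, y) \<in> reach {e \<in> edges. \<omega> e}} \<subseteq> {y. (x, y) \<in> reach {e \<in> edges. \<omega> e}}" by auto
    then have "infinite {y. (x, y) \<in> reach {e \<in> edges. \<omega> e}}"
      using w finite_subset unfolding Ev_def by blast
    then show "\<omega> \<in> infinite_cluster_event V E"
      using w that outerV unfolding infinite_cluster_event_eq[OF sg] Ev_def by blast
  qed
  have CEv: "infinite_cluster_event V E \<subseteq> (\<Union>x\<in>outer. Ev x)"
  proof
    fix \<omega> assume "\<omega> \<in> infinite_cluster_event V E"
    then obtain x where x: "\<omega> \<in> edges \<rightarrow>\<^sub>E UNIV" "x \<in> ladder_verts V"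
      "infinite {y. (x, y) \<in> reach {e \<in> edges. \<omega> e}}"
      unfolding infinite_cluster_event_eq[OF sg] by blast
    obtain a where "a \<in> outer" "infinite {y \<in> outer. (a, y) \<in> reach {e \<in> edges. \<omega> e}}"
      using infinite_outer_cluster[OF _ x(2,3)] by blast
    then show "\<omega> \<in> (\<Union>x\<in>outer. Ev x)" using x(1) unfolding Ev_def by blast
  qed
  have \<rho>01: "0 \<le> \<rho> e \<and> \<rho> e \<le> 1" "0 \<le> \<rho>' e \<and> \<rho>' e \<le> 1" if "e \<in> edges" for e
    using P[OF that] Q[OF that] d(1) \<delta>(1) by (cases "e \<in> Col"; force)+
  have blk: "{e \<in> edges. key e = Inl n} = block n" for n by (simp add: block_def)
  have single: "{e \<in> edges. key e = Inr f} \<subseteq> {f}" for f by (auto simp: key_def)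
  have dom: "block_dominated \<rho> \<rho>' (inner k) {e \<in> edges. key e = k}" if k: "k \<in> key ` edges" for k
  proof (cases k)
    case (Inl n)
    have un: "block n = block n \<inter> Col \<union> (block n - Col)" by auto
    have be: "block n \<subseteq> edges" by (auto simp: block_def)
    have "block_dominated \<rho> \<rho>' (inner k) (block n \<inter> Col \<union> (block n - Col))"
    proof (rule block_dominatedI[where \<eta> = "pattern n"])
      show "finite (block n - Col)" "finite (block n \<inter> Col)" using size by auto
      show "card (block n \<inter> Col \<union> (block n - Col)) \<le> N" using size un by metis
      show "pattern n \<subseteq> block n \<inter> Col" by (auto simp: pattern_def)
      show "connects_less (inner k) (pattern n) {}" using pattern_isolates Inl by simp
      show "connects_less (inner k) (block n \<inter> Col \<union> (block n - Col)) (pattern n \<union> (block n - Col))"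
        using pattern_connects[of n] un Inl by simp
    qed (use d \<delta> \<epsilon> P Q be in auto)
    then show ?thesis unfolding Inl blk un[symmetric] .
  next
    case (Inr f)
    then obtain e where e: "e \<in> edges" "key e = Inr f" using k by auto
    then have f: "e = f" "fst ` f \<inter> set xs = {}" by (auto simp: key_def split: if_splits)
    have "{e \<in> edges. key e = k} = {f}" using e f Inr single by auto
    moreover have "f \<notin> Col"
    proof
      assume "f \<in> Col"
      then have "fst ` f = {}" using col_base[of f] f(2) by auto
      moreover have "f \<noteq> {}" using e(1) f(1) unfolding ladder_edges_def by auto
      ultimately show False by simp
    qed
    then have "0 \<le> \<rho> f" "\<rho> f \<le> \<rho>' f" "\<rho>' f \<le> 1" using P[of f] e f d(1) by auto
    ultimately show ?thesis using block_dominated_single by metis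
  qed
  have finB: "finite {e \<in> edges. key e = k}" for k
    using size single[of "projr k"] by (cases k) (auto simp: blk intro: finite_subset)
  have comp: "Ev x \<in> P.events \<and> P.prob (Ev x) \<le> P'.prob (Ev x)" if "x \<in> outer" for x
    unfolding Ev_def
    by (intro conjI infinite_reach_comparison[where \<rho>' = \<rho>' and \<kappa> = key and T = inner])
      (use countable_ladder_edges[OF sg cV] ladder_edge_finite finB \<rho>01 key_of_inner
        outer_inner_disjoint dom that in auto)
  have "P.prob (Ev x) = 0" if "x \<in> outer" for x
  proof -
    have "P'.prob (Ev x) \<le> P'.prob (infinite_cluster_event V E)"
      by (rule P'.finite_measure_mono[OF EvC[OF that] ev'])
    then show ?thesis using comp[OF that] null' by (simp add: measure_le_0_iff)
  qed
  then have "Ev x \<in> null_sets (bern_product \<rho> edges)" if "x \<in> outer" for x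
    using comp[OF that] that by (intro null_setsI) (auto simp: P.emeasure_eq_measure)
  moreover have "countable outer"
    by (rule countable_subset[OF outerV]) (simp add: cV ladder_verts_def)
  ultimately have null: "(\<Union>x\<in>outer. Ev x) \<in> null_sets (bern_product \<rho> edges)"
    by (intro null_sets_UN') auto
  have "infinite_cluster_event V E \<in> null_sets (bern_product \<rho> edges)"
    by (rule null_sets_subset[OF null ev CEv])
  then have "P.prob (infinite_cluster_event V E) = 0" by (simp add: measure_eq_0_null_sets)
  with pos show False by simp
qed

end

section \<open>Percolation with distinguished columns\<close>

lemma percolation_eq_bern_product:
  "percolation V E K L u v w q p = bern_product (edge_prob K L u v w q p) (ladder_edges V E)"
  by (simp add: percolation_def bern_product_def)

text \<open>The data of the theorem.\<close>
locale ladder_columns =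
  fixes V :: "'v set" and E :: "'v set set" and K L :: nat and u v w :: "nat \<Rightarrow> 'v"
  assumes connected: "connected_graph V E"
    and rungs: "\<And>i. i \<in> {1..K} \<Longrightarrow> {u i, v i} \<in> E"
    and rungs_distinct: "inj_on (\<lambda>i. {u i, v i}) {1..K}"
    and lines: "\<And>j. j \<in> {1..L} \<Longrightarrow> w j \<in> V"
    and lines_distinct: "inj_on w {1..L}"
begin

abbreviation "params \<equiv> {1..K + L} \<rightarrow>\<^sub>E {0<..<1::real}"
abbreviation "prob q p \<equiv> edge_prob K L u v w q p"
abbreviation "perc q p \<equiv> measure (percolation V E K L u v w q p) (infinite_cluster_event V E)"

text \<open>The edges of all distinguished columns, and the vertices of the base graph below them.\<close>
definition column_edges :: "('v \<times> int) set set" where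
  "column_edges = (\<Union>i\<in>{1..K + L}. column K u v w i)"

definition column_verts :: "'v set" where
  "column_verts = u ` {1..K} \<union> v ` {1..K} \<union> w ` {1..L}"

lemma simple: "simple_graph V E"
  using connected by (simp add: connected_graph_def)

lemma rung_verts:
  assumes "i \<in> {1..K}" shows "u i \<noteq> v i" "u i \<in> V" "v i \<in> V"
proof -
  obtain a b where "a \<in> V" "b \<in> V" "a \<noteq> b" "{u i, v i} = {a, b}"
    using rungs[OF assms] simple unfolding simple_graph_def by blast
  then show "u i \<noteq> v i" "u i \<in> V" "v i \<in> V" by (auto simp: doubleton_eq_iff)
qed

lemma prob_outside: "e \<notin> column_edges \<Longrightarrow> prob q p e = p"
  by (auto simp: edge_prob_def column_edges_def)

lemma prob_column:
  assumes "e \<in> column_edges"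
  obtains i where "i \<in> {1..K + L}" "\<And>q p. prob q p e = q i"
proof -
  obtain i where i: "i \<in> {1..K + L}" "e \<in> column K u v w i"
    using assms by (auto simp: column_edges_def)
  have "prob q p e = q i" for q p
    using rung_verts(1) rungs_distinct lines_distinct i by (intro edge_prob_column) auto
  then show ?thesis using that i(1) by blast
qed

lemma column_cases:
  assumes "e \<in> column_edges"
  obtains (rung) i h where "i \<in> {1..K}" "e = {(u i, h), (v i, h)}"
    | (line) j h where "j \<in> {1..L}" "e = {(w j, h), (w j, h + 1)}"
proof -
  obtain i where i: "i \<in> {1..K + L}" "e \<in> column K u v w i"
    using assms by (auto simp: column_edges_def)
  show ?thesis
  proof (cases "i \<le> K")
    case True
    then show ?thesis using i rung[of i] by (auto simp: column_def)
  next
    case False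
    then have "i - K \<in> {1..L}" using i(1) by auto
    then show ?thesis using i(2) False line[of "i - K"] by (auto simp: column_def)
  qed
qed

lemma column_base: "e \<in> column_edges \<Longrightarrow> fst ` e \<subseteq> column_verts"
  by (erule column_cases) (auto simp: column_verts_def)

lemma column_verts_finite: "finite column_verts" "column_verts \<subseteq> V"
  using rung_verts lines by (auto simp: column_verts_def)

lemma column_line:
  assumes "{(a, h), (a, h + 1)} \<in> column_edges" shows "a \<in> column_verts"
  using column_base[OF assms] by auto

lemma prob_bounds:
  assumes "\<And>i. i \<in> {1..K + L} \<Longrightarrow> a \<le> q i \<and> q i \<le> b" "a \<le> p" "p \<le> b"
  shows "a \<le> prob q p e \<and> prob q p e \<le> b"
proof (cases "e \<in> column_edges")
  case True
  then show ?thesis using assms(1) by (auto elim!: prob_column)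
qed (use assms in \<open>simp add: prob_outside\<close>)

lemma sets_percolation_cong:
  "sets (percolation V E K L u v w q p) = sets (percolation V E K L u v w q' p')"
  unfolding percolation_eq_bern_product by (rule sets_bern_product_cong)

text \<open>The parameters of finitely many columns stay away from 0 and 1.\<close>
lemma params_margin:
  assumes "q \<in> params"
  obtains \<delta> where "0 < \<delta>" "\<delta> \<le> 1 / 2" "\<And>i. i \<in> {1..K + L} \<Longrightarrow> 2 * \<delta> \<le> q i \<and> q i \<le> 1 - 2 * \<delta>"
proof -
  define \<delta> where "\<delta> = Min (insert (1 / 2) ((\<lambda>i. min (q i) (1 - q i) / 2) ` {1..K + L}))"
  have "q i \<in> {0<..<1}" if "i \<in> {1..K + L}" for i using assms that by (rule PiE_mem)
  then have "0 < \<delta>" unfolding \<delta>_def by (subst Min_gr_iff) auto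
  moreover have "\<delta> \<le> 1 / 2" unfolding \<delta>_def by (rule Min_le) auto
  moreover have "2 * \<delta> \<le> q i \<and> q i \<le> 1 - 2 * \<delta>" if "i \<in> {1..K + L}" for i
  proof -
    have "\<delta> \<le> min (q i) (1 - q i) / 2" unfolding \<delta>_def by (rule Min_le) (use that in auto)
    then show ?thesis by (simp add: min_def split: if_splits)
  qed
  ultimately show ?thesis using that by blast
qed

text \<open>With \<open>p = 0\<close> only the columns can be open, and these live over finitely many vertices.\<close>
lemma perc_zero:
  assumes "q \<in> params"
  shows "perc q 0 = 0"
proof (cases "infinite_cluster_event V E \<in> sets (percolation V E K L u v w q 0)")
  case True
  obtain \<delta> where \<delta>: "0 < \<delta>" "\<delta> \<le> 1 / 2"
    "\<And>i. i \<in> {1..K + L} \<Longrightarrow> 2 * \<delta> \<le> q i \<and> q i \<le> 1 - 2 * \<delta>"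
    using params_margin[OF assms] by metis
  have b: "0 \<le> prob q 0 e \<and> prob q 0 e \<le> 1 - \<delta>" for e
  proof (rule prob_bounds)
    show "0 \<le> q i \<and> q i \<le> 1 - \<delta>" if "i \<in> {1..K + L}" for i using \<delta>(1) \<delta>(3)[OF that] by linarith
  qed (use \<delta> in auto)
  have cV: "countable V"
    using countable_of_measurable_event[OF simple] True unfolding percolation_eq_bern_product by blast
  show ?thesis
    unfolding percolation_eq_bern_product
  proof (rule no_percolation_finite_base[OF simple cV column_verts_finite])
    show "0 \<le> prob q 0 e \<and> prob q 0 e \<le> 1" for e using b[of e] \<delta>(1) by linarith
    show "prob q 0 e = 0" if "\<not> e \<subseteq> column_verts \<times> UNIV" for e
    proof (rule prob_outside)
      show "e \<notin> column_edges" using that column_base[of e] by force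
    qed
    show "prob q 0 {(x, h), (x, h + 1)} \<le> 1 - \<delta>" for x h using b by blast
  qed (use \<delta> in auto)
qed (simp add: measure_notin_sets)

text \<open>The trade-off between the columns and the other edges: near \<open>q\<close>, an increase of \<open>p\<close> by \<open>d\<close>
  compensates every small change of the column parameters. Percolation with positive probability
  already forces the event to be measurable, hence \<open>V\<close> to be countable.\<close>
lemma perc_trade_off:
  assumes q: "q \<in> params" and d: "0 < d"
  shows "\<exists>\<epsilon>>0. \<forall>qa qb p1 p2. (\<forall>i\<in>{1..K + L}. \<bar>qa i - q i\<bar> < \<epsilon> \<and> \<bar>qb i - q i\<bar> < \<epsilon>) \<longrightarrow>
    0 \<le> p1 \<longrightarrow> p1 + d \<le> p2 \<longrightarrow> p2 \<le> 1 \<longrightarrow> 0 < perc qa p1 \<longrightarrow> 0 < perc qb p2"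
proof -
  obtain \<delta> where \<delta>: "0 < \<delta>" "\<delta> \<le> 1 / 2"
    "\<And>i. i \<in> {1..K + L} \<Longrightarrow> 2 * \<delta> \<le> q i \<and> q i \<le> 1 - 2 * \<delta>"
    using params_margin[OF q] by metis
  have near: "\<delta> \<le> q' i \<and> q' i \<le> 1 - \<delta>"
    if "\<bar>q' i - q i\<bar> < \<delta>" "i \<in> {1..K + L}" for q' i
    using \<delta>(3)[OF that(2)] that(1) by linarith
  have ms: "infinite_cluster_event V E \<in> sets (percolation V E K L u v w q' p')"
    if "0 < perc qa p1" for q' p' qa p1
  proof -
    have "infinite_cluster_event V E \<in> sets (percolation V E K L u v w qa p1)"
      using that measure_notin_sets[of "infinite_cluster_event V E" "percolation V E K L u v w qa p1"]
      by (cases "infinite_cluster_event V E \<in> sets (percolation V E K L u v w qa p1)") auto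
    then show ?thesis unfolding sets_percolation_cong[of qa p1 q' p'] .
  qed
  have cV: "countable V" if "0 < perc qa p1" for qa p1
    using countable_of_measurable_event[OF simple] ms[OF that, of qa p1]
    unfolding percolation_eq_bern_product by blast
  \<comment> \<open>Over a finite base there is no percolation at \<open>p1 < 1\<close>, and at a vertex of infinite degree there
    always is at \<open>p2 > 0\<close>. The blocks are needed in the remaining case only.\<close>
  consider "finite V" | a where "infinite {b. {a, b} \<in> E}"
    | "infinite V" "\<And>a. finite {b. {a, b} \<in> E}" by blast
  then show ?thesis
  proof cases
    case 1
    show ?thesis
    proof (intro exI[of _ \<delta>] conjI allI impI)
      fix qa qb p1 p2
      assume *: "\<forall>i\<in>{1..K + L}. \<bar>qa i - q i\<bar> < \<delta> \<and> \<bar>qb i - q i\<bar> < \<delta>"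
        "0 \<le> p1" "p1 + d \<le> p2" "p2 \<le> 1" "0 < perc qa p1"
      have b: "0 \<le> prob qa p1 e \<and> prob qa p1 e \<le> 1 - min \<delta> d" for e
      proof (rule prob_bounds)
        show "0 \<le> qa i \<and> qa i \<le> 1 - min \<delta> d" if "i \<in> {1..K + L}" for i
          using near[of qa i] bspec[OF *(1) that] that \<delta>(1) by auto
      qed (use *(2-4) in auto)
      have "perc qa p1 = 0"
        unfolding percolation_eq_bern_product
      proof (rule no_percolation_finite_base[OF simple cV[OF *(5)] 1 order_refl, where c = "min \<delta> d"])
        show "0 \<le> prob qa p1 e \<and> prob qa p1 e \<le> 1" for e using b[of e] \<delta>(1) d by linarith
        show "prob qa p1 e = 0" if "e \<in> ladder_edges V E" "\<not> e \<subseteq> V \<times> UNIV" for e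
          using ladder_edge_subset[OF simple that(1)] that(2) by (simp add: ladder_verts_def)
        show "prob qa p1 {(x, h), (x, h + 1)} \<le> 1 - min \<delta> d" for x h using b by blast
      qed (use \<delta> d in auto)
      with *(5) show "0 < perc qb p2" by simp
    qed (rule \<delta>(1))
  next
    case 2
    show ?thesis
    proof (intro exI[of _ \<delta>] conjI allI impI)
      fix qa qb p1 p2
      assume *: "\<forall>i\<in>{1..K + L}. \<bar>qa i - q i\<bar> < \<delta> \<and> \<bar>qb i - q i\<bar> < \<delta>"
        "0 \<le> p1" "p1 + d \<le> p2" "p2 \<le> 1" "0 < perc qa p1"
      have b: "min \<delta> d \<le> prob qb p2 e \<and> prob qb p2 e \<le> 1" for e
      proof (rule prob_bounds)
        show "min \<delta> d \<le> qb i \<and> qb i \<le> 1" if "i \<in> {1..K + L}" for i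
          using near[of qb i] bspec[OF *(1) that] that \<delta>(1) by auto
      qed (use *(2-4) in auto)
      have "perc qb p2 = 1"
        unfolding percolation_eq_bern_product
      proof (rule percolation_infinite_degree[OF simple 2, where c = "min \<delta> d"])
        show "0 \<le> prob qb p2 e \<and> prob qb p2 e \<le> 1" for e using b[of e] \<delta>(1) d by linarith
        show "min \<delta> d \<le> prob qb p2 e" for e using b by blast
        show "infinite_cluster_event V E \<in> sets (bern_product (prob qb p2) (ladder_edges V E))"
          using ms[OF *(5)] unfolding percolation_eq_bern_product .
      qed (use \<delta> d in auto)
      then show "0 < perc qb p2" by simp
    qed (rule \<delta>(1))
  next
    case 3
    \<comment> \<open>The blocks stand over a part that contains all neighbours of the columns and starts at a vertex
      off the columns; lines over its rim then consist of edges with parameter \<open>p\<close>.\<close>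
    define nbh where "nbh = column_verts \<union> (\<Union>a\<in>column_verts. {b. {a, b} \<in> E})"
    have nbh: "finite nbh" "nbh \<subseteq> V"
    proof -
      show "finite nbh" using column_verts_finite 3(2) by (simp add: nbh_def)
      have "\<Union>E \<subseteq> V" using simple by (auto simp: simple_graph_def)
      then show "nbh \<subseteq> V" using column_verts_finite(2) by (auto simp: nbh_def)
    qed
    obtain r where r: "r \<in> V" "r \<notin> column_verts"
      using 3(1) column_verts_finite(1) by (meson finite_subset subsetI)
    obtain xs where xs: "xs \<noteq> []" "xs ! 0 = r" "distinct xs" "set xs \<subseteq> V" "nbh \<subseteq> set xs"
      "\<forall>i<length xs. 0 < i \<longrightarrow> (\<exists>j<i. {xs ! i, xs ! j} \<in> E)"
      using exists_growth_list[OF connected nbh r(1)] by blast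
    interpret ladder_blocks V E column_edges xs
    proof
      show "fst ` e \<subseteq> set xs" if "e \<in> column_edges" for e
        using column_base[OF that] xs(5) by (auto simp: nbh_def)
      show "{(xs ! 0, h), (xs ! 0, h + 1)} \<notin> column_edges" for h
        using column_line[of r h] r(2) xs(2) by auto
      show "{(z, h), (z, h + 1)} \<notin> column_edges"
        if "{y, z} \<in> E" "y \<notin> set xs" "z \<in> set xs" for y z h
      proof
        assume "{(z, h), (z, h + 1)} \<in> column_edges"
        then have "y \<in> nbh" using column_line that(1) by (force simp: nbh_def insert_commute)
        then show False using that(2) xs(5) by auto
      qed
    qed (use simple 3(2) xs in auto)
    obtain N where N: "\<And>n. finite (block n) \<and> card (block n) \<le> N" using block_size by blast
    define d' where "d' = min d 1"
    have d': "0 < d'" "d' \<le> 1" using d by (auto simp: d'_def)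
    define \<epsilon> where "\<epsilon> = min \<delta> ((\<delta> * d') ^ N / (2 * real N + 1))"
    have \<epsilon>: "0 < \<epsilon>" "\<epsilon> \<le> \<delta>" "real N * (2 * \<epsilon>) \<le> (\<delta> * d') ^ N"
    proof -
      show "0 < \<epsilon>" using \<delta>(1) d' by (simp add: \<epsilon>_def)
      show "\<epsilon> \<le> \<delta>" by (simp add: \<epsilon>_def)
      have "(2 * real N + 1) * \<epsilon> \<le> (2 * real N + 1) * ((\<delta> * d') ^ N / (2 * real N + 1))"
        by (intro mult_left_mono) (auto simp: \<epsilon>_def)
      also have "\<dots> = (\<delta> * d') ^ N" by simp
      finally show "real N * (2 * \<epsilon>) \<le> (\<delta> * d') ^ N" using \<open>0 < \<epsilon>\<close> by (simp add: algebra_simps)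
    qed
    show ?thesis
    proof (intro exI[of _ \<epsilon>] conjI allI impI)
      fix qa qb p1 p2
      assume *: "\<forall>i\<in>{1..K + L}. \<bar>qa i - q i\<bar> < \<epsilon> \<and> \<bar>qb i - q i\<bar> < \<epsilon>"
        "0 \<le> p1" "p1 + d \<le> p2" "p2 \<le> 1" "0 < perc qa p1"
      have col: "0 \<le> prob qa p1 e \<and> prob qa p1 e \<le> 1 \<and> \<delta> \<le> prob qb p2 e \<and> prob qb p2 e \<le> 1 - \<delta> \<and>
          \<bar>prob qa p1 e - prob qb p2 e\<bar> \<le> 2 * \<epsilon>" if "e \<in> column_edges" for e
        using that
      proof (rule prob_column)
        fix i assume i: "i \<in> {1..K + L}" "\<And>q p. prob q p e = q i"
        have "\<bar>qa i - q i\<bar> < \<epsilon>" "\<bar>qb i - q i\<bar> < \<epsilon>" using *(1) i(1) by auto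
        then show ?thesis unfolding i(2) using near[of qa i] near[of qb i] i(1) \<epsilon>(2) \<delta>(1) by auto
      qed
      show "0 < perc qb p2"
        unfolding percolation_eq_bern_product
      proof (rule percolation_comparison[OF cV[OF *(5)] N d' \<delta>(1) _ _ \<epsilon>(3)])
        show "0 \<le> prob qa p1 e \<and> prob qa p1 e + d' \<le> prob qb p2 e \<and> prob qb p2 e \<le> 1"
          if "e \<notin> column_edges" for e
          using that *(2-4) by (auto simp: prob_outside d'_def)
        show "0 < measure (bern_product (prob qa p1) (ladder_edges V E)) (infinite_cluster_event V E)"
          using *(5) unfolding percolation_eq_bern_product .
        show "infinite_cluster_event V E \<in> sets (bern_product (prob qa p1) (ladder_edges V E))"
          using ms[OF *(5)] unfolding percolation_eq_bern_product .
      qed (use \<delta> \<epsilon> col in auto)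
    qed (rule \<epsilon>(1))
  qed
qed

section \<open>Continuity of the critical parameter\<close>

abbreviation "crit q \<equiv> critical_param V E K L u v w q"

lemma perc_pos_above_crit: "0 \<le> p \<Longrightarrow> p \<le> 1 \<Longrightarrow> crit q < p \<Longrightarrow> 0 < perc q p"
proof (rule ccontr)
  assume *: "0 \<le> p" "p \<le> 1" "crit q < p" "\<not> 0 < perc q p"
  then have "p \<in> {p \<in> {0..1}. perc q p = 0}" by (simp add: zero_less_measure_iff)
  then have "p \<le> crit q" unfolding critical_param_def by (intro cSup_upper) auto
  with *(3) show False by simp
qed

lemma crit_nonneg: "q \<in> params \<Longrightarrow> 0 \<le> crit q"
  unfolding critical_param_def using perc_zero by (intro cSup_upper) auto

lemma perc_zero_below_crit:
  assumes "q \<in> params" "x < crit q"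
  shows "\<exists>p>x. p \<le> 1 \<and> perc q p = 0"
proof -
  have "{p \<in> {0..1}. perc q p = 0} \<noteq> {}" using perc_zero[OF assms(1)] by (auto intro!: exI[of _ 0])
  then have "\<exists>p\<in>{p \<in> {0..1}. perc q p = 0}. x < p"
    using assms(2) unfolding critical_param_def by (subst (asm) less_cSup_iff) auto
  then show ?thesis by auto
qed

theorem continuous_on_crit: "continuous_on params crit"
  unfolding continuous_on_def
proof (intro ballI tendstoI)
  fix q :: "nat \<Rightarrow> real" and e :: real assume q: "q \<in> params" and e: "0 < e"
  define d where "d = e / 4"
  have d: "0 < d" using e by (simp add: d_def)
  obtain \<epsilon> where \<epsilon>: "0 < \<epsilon>" and trade: "\<And>qa qb p1 p2.
      (\<forall>i\<in>{1..K + L}. \<bar>qa i - q i\<bar> < \<epsilon> \<and> \<bar>qb i - q i\<bar> < \<epsilon>) \<Longrightarrow>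
      0 \<le> p1 \<Longrightarrow> p1 + d \<le> p2 \<Longrightarrow> p2 \<le> 1 \<Longrightarrow> 0 < perc qa p1 \<Longrightarrow> 0 < perc qb p2"
    using perc_trade_off[OF q d] by blast
  \<comment> \<open>A gap between the two critical values leaves room for \<open>p1\<close> and \<open>p2\<close> inside it.\<close>
  have le: "crit qb \<le> crit qa + 2 * d"
    if qa: "qa \<in> params" and qb: "qb \<in> params"
      and close: "\<forall>i\<in>{1..K + L}. \<bar>qa i - q i\<bar> < \<epsilon> \<and> \<bar>qb i - q i\<bar> < \<epsilon>" for qa qb
  proof (rule ccontr)
    assume "\<not> ?thesis"
    then obtain p2 where p2: "crit qa + 2 * d < p2" "p2 \<le> 1" "perc qb p2 = 0"
      using perc_zero_below_crit[OF qb, of "crit qa + 2 * d"] by auto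
    have "0 < perc qa (crit qa + d)"
      using crit_nonneg[OF qa] d p2 by (intro perc_pos_above_crit) auto
    then have "0 < perc qb p2"
      using crit_nonneg[OF qa] d p2 by (intro trade[OF close, of "crit qa + d"]) auto
    then show False using p2(3) by simp
  qed
  define U where "U = (\<Inter>i\<in>{1..K + L}. {q'. \<bar>q' i - q i\<bar> < \<epsilon>})"
  have "open U" unfolding U_def
    by (intro open_INT ballI open_Collect_less continuous_intros) auto
  moreover have "q \<in> U" using \<epsilon> by (simp add: U_def)
  moreover have "dist (crit q') (crit q) < e" if "q' \<in> U" "q' \<in> params" for q'
  proof -
    have "crit q' \<le> crit q + 2 * d" "crit q \<le> crit q' + 2 * d"
      using that \<epsilon> q by (auto intro!: le simp: U_def)
    then show ?thesis using e by (simp add: dist_real_def d_def abs_if)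
  qed
  ultimately show "\<forall>\<^sub>F q' in at q within params. dist (crit q') (crit q) < e"
    unfolding eventually_at_topological by blast
qed

end

theorem theorem1:
  fixes V :: "'v set" and E :: "'v set set"
    and K L :: nat and u v w :: "nat \<Rightarrow> 'v"
  assumes "connected_graph V E"
    and "\<And>i. i \<in> {1..K} \<Longrightarrow> {u i, v i} \<in> E"
    and "inj_on (\<lambda>i. {u i, v i}) {1..K}"
    and "\<And>j. j \<in> {1..L} \<Longrightarrow> w j \<in> V"
    and "inj_on w {1..L}"
  shows "continuous_on ({1..K + L} \<rightarrow>\<^sub>E {0<..<1::real})
           (\<lambda>q. critical_param V E K L u v w q)"
proof -
  interpret ladder_columns V E K L u v w
    using assms by unfold_locales
  show ?thesis by (rule continuous_on_crit)
qed

end
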